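(* Consider a multilayer perceptron with $L$ fully connected layers of constant layer size $d$ (each weight matrix is $d\times d$), with $N=d^2L$ weights and $n$ data points, and let $H\in\mathbb{R}^{N\times N}$ be its Gauss-Newton Hessian matrix (as defined in the context). There is a precomputation that requires $\mathcal{O}(nN)$ storage and $\mathcal{O}(dnN)$ work such that, after it has been carried out, every entry $H_{km}$ ($k,m\in\{1,\dots,N\}$) can be computed in $\mathcal{O}(dn)$ time.
   Context: Network: given data pairs $(x_i^0,y_i)$, $i=1,\dots,n$, with $x_i^0\in\mathbb{R}^d$, and weight matrices $W_\ell\in\mathbb{R}^{d\times d}$, $\ell=1,\dots,L$, the forward pass is $x_i^\ell=s(W_\ell x_i^{\ell-1})\in\mathbb{R}^d$ for $\ell=1,\dots,L$, where $s$ is a (differentiable) scalar activation function applied to every entry of its argument. The weight vector is $w=[\mathrm{vec}(W_1),\dots,\mathrm{vec}(W_L)]\in\mathbb{R}^N$, where $N=d^2L$ and $\mathrm{vec}$ is column-major vectorization. Gauss-Newton Hessian (GNH): $f(x_i^L,y_i)$ is the loss function, $Q_i=\frac1n\,\partial^2_{xx}f(x_i^L,y_i)\in\mathbb{R}^{d\times d}$ is ($\frac1n$ times) the Hessian of the loss with respect to its first argument, $J_i=\partial_w x_i^L\in\mathbb{R}^{d\times N}$ is the Jacobian of the network output with respect to the weights, and $$H=\sum_{i=1}^n J_i^TQ_iJ_i\in\mathbb{R}^{N\times N}.$$ Each $Q_i$ is symmetric positive semi-definite, so it admits a symmetric factorization $Q_i=R_i^TR_i$ with $R_i\in\mathbb{R}^{d\times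 d}$. Cost model: work/time is the number of real arithmetic operations (including square roots and comparisons) and storage is the number of real numbers stored; an evaluation of $s$ or of its derivative $\dot s$ at a scalar costs $\mathcal{O}(1)$. The weights, the data and the matrices $Q_i$ are available as input (once the network outputs are known). A symmetric factorization of a $d\times d$ matrix costs $\mathcal{O}(d^3)$ work. The implied constants in $\mathcal{O}(\cdot)$ are absolute (independent of $d,L,n,N$). *)

theory Defs
  imports "HOL-Analysis.Derivative" "Jordan_Normal_Form.Matrix"
begin

unbundle no vec_syntax
unbundle no inner_syntax
hide_const (open) Finite_Cartesian_Product.vec

section \<open>The network and its Gauss-Newton Hessian\<close>

text \<open>Layers are numbered from 1, as in \<open>x\<^sup>l = s(W\<^sub>l x\<^sup>l\<^sup>-\<^sup>1)\<close>; data points, weights and vector and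
  matrix entries are numbered from 0, as in the matrix library.\<close>

fun forward :: "(real \<Rightarrow> real) \<Rightarrow> (nat \<Rightarrow> real mat) \<Rightarrow> real vec \<Rightarrow> nat \<Rightarrow> real vec" where
  "forward s W x 0 = x"
| "forward s W x (Suc l) = map_vec s (W (Suc l) *\<^sub>v forward s W x l)"

text \<open>\<open>w = [vec W\<^sub>1, \<dots>, vec W\<^sub>L]\<close>, where \<open>vec\<close> is column-major: entry \<open>(r, c)\<close> of \<open>W\<^sub>l\<close> is
  number \<open>(l - 1) d\<^sup>2 + c d + r\<close>.\<close>

definition weight_vec :: "nat \<Rightarrow> nat \<Rightarrow> (nat \<Rightarrow> real mat) \<Rightarrow> real vec" where
  "weight_vec d L W = vec (d^2 * L) (\<lambda>k. W (k div d^2 + 1) $$ (k mod d, k mod d^2 div d))"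

definition layer_weights :: "nat \<Rightarrow> real vec \<Rightarrow> nat \<Rightarrow> real mat" where
  "layer_weights d w l = mat d d (\<lambda>(r, c). w $ ((l - 1) * d^2 + c * d + r))"

lemma layer_weights_weight_vec:
  assumes W: "W l \<in> carrier_mat d d" and l: "1 \<le> l" "l \<le> L"
  shows "layer_weights d (weight_vec d L W) l = W l"
proof (rule eq_matI)
  fix r c assume "r < dim_row (W l)" "c < dim_col (W l)"
  with W have r: "r < d" and c: "c < d" by auto
  let ?j = "c * d + r" and ?k = "(l - 1) * d^2 + c * d + r"
  have "?j < (c + 1) * d" using r by simp
  also have "\<dots> \<le> d * d" using c by (intro mult_right_mono) auto
  finally have j: "?j < d^2" by (simp add: power2_eq_square)
  have k: "?k = (l - 1) * d^2 + ?j" by simp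
  have "?k < (l - 1 + 1) * d^2" using j by simp
  also have "\<dots> \<le> L * d^2" using l by (intro mult_right_mono) auto
  finally have lt: "?k < d^2 * L" by (simp add: mult.commute)
  have "d^2 \<noteq> 0" using j by linarith
  then have "?k div d^2 + 1 = l" using j l unfolding k by (simp add: div_mult_self3)
  moreover have "?k mod d^2 = ?j" using j unfolding k by simp
  moreover have "?j div d = c" using r by simp
  moreover have "?k mod d = r"
  proof -
    have "?k = r + ((l - 1) * d + c) * d" by (simp add: power2_eq_square algebra_simps)
    then show ?thesis using r by (metis mod_less mod_mult_self1)
  qed
  ultimately show "layer_weights d (weight_vec d L W) l $$ (r, c) = W l $$ (r, c)"
    using r c lt by (simp add: layer_weights_def weight_vec_def)
qed (use W in \<open>auto simp: layer_weights_def\<close>)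

definition partial_differentiable :: "(real vec \<Rightarrow> real) \<Rightarrow> nat \<Rightarrow> real vec \<Rightarrow> bool" where
  "partial_differentiable g a x \<longleftrightarrow> (\<lambda>t. g (x |\<^sub>v a \<mapsto> t)) differentiable (at (x $ a))"

definition partial_deriv :: "(real vec \<Rightarrow> real) \<Rightarrow> nat \<Rightarrow> real vec \<Rightarrow> real" where
  "partial_deriv g a x = deriv (\<lambda>t. g (x |\<^sub>v a \<mapsto> t)) (x $ a)"

definition hessian :: "(real vec \<Rightarrow> real) \<Rightarrow> real vec \<Rightarrow> real mat" where
  "hessian g x =
     mat (dim_vec x) (dim_vec x) (\<lambda>(a, b). partial_deriv (partial_deriv g b) a x)"

text \<open>The derivatives occurring in \<^const>\<open>hessian\<close> exist.\<close>

definition has_hessian_at :: "(real vec \<Rightarrow> real) \<Rightarrow> real vec \<Rightarrow> bool" where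
  "has_hessian_at g x \<longleftrightarrow>
     (\<exists>e>0. \<forall>z \<in> carrier_vec (dim_vec x).
        (\<forall>j < dim_vec x. \<bar>z $ j - x $ j\<bar> < e) \<longrightarrow>
        (\<forall>b < dim_vec x. partial_differentiable g b z)) \<and>
     (\<forall>a < dim_vec x. \<forall>b < dim_vec x. partial_differentiable (partial_deriv g b) a x)"

definition output_jacobian ::
    "(real \<Rightarrow> real) \<Rightarrow> nat \<Rightarrow> nat \<Rightarrow> (nat \<Rightarrow> real mat) \<Rightarrow> real vec \<Rightarrow> real mat" where
  "output_jacobian s d L W x =
     mat d (d^2 * L) (\<lambda>(r, m).
       partial_deriv (\<lambda>w. forward s (layer_weights d w) x L $ r) m (weight_vec d L W))"

definition loss_hessian ::
    "(real \<Rightarrow> real) \<Rightarrow> nat \<Rightarrow> nat \<Rightarrow> (nat \<Rightarrow> real mat) \<Rightarrow> (nat \<Rightarrow> real vec) \<Rightarrow>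
      (real vec \<Rightarrow> 'y \<Rightarrow> real) \<Rightarrow> (nat \<Rightarrow> 'y) \<Rightarrow> nat \<Rightarrow> real mat" where
  "loss_hessian s L n W x f y i =
     (1 / real n) \<cdot>\<^sub>m hessian (\<lambda>z. f z (y i)) (forward s W (x i) L)"

definition gauss_newton_hessian ::
    "(real \<Rightarrow> real) \<Rightarrow> nat \<Rightarrow> nat \<Rightarrow> nat \<Rightarrow> (nat \<Rightarrow> real mat) \<Rightarrow> (nat \<Rightarrow> real vec) \<Rightarrow>
      (real vec \<Rightarrow> 'y \<Rightarrow> real) \<Rightarrow> (nat \<Rightarrow> 'y) \<Rightarrow> real mat" where
  "gauss_newton_hessian s d L n W x f y =
     mat (d^2 * L) (d^2 * L) (\<lambda>km. \<Sum>i<n.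
       (transpose_mat (output_jacobian s d L W (x i)) * loss_hessian s L n W x f y i *
        output_jacobian s d L W (x i)) $$ km)"

definition sym_pos_semidef :: "nat \<Rightarrow> real mat \<Rightarrow> bool" where
  "sym_pos_semidef d Q \<longleftrightarrow>
     Q \<in> carrier_mat d d \<and> transpose_mat Q = Q \<and> (\<forall>v \<in> carrier_vec d. v \<bullet> (Q *\<^sub>v v) \<ge> 0)"

section \<open>The machine model\<close>

text \<open>
  A program is a text in a small loop language over real arrays, so that one program serves all
  sizes. Array subscripts and loop bounds are computed from natural-number index variables;
  the only influence of real numbers on the flow of control is through comparisons. The
  activation and its derivative are unknown to the program, which can only have them evaluated
  at a scalar.
\<close>

type_synonym vname = string
type_synonym cell = "string \<times> nat"

datatype iexp =
    IConst nat
  | IVar vname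
  | IAdd iexp iexp
  | ISub iexp iexp
  | IMul iexp iexp
  | IDiv iexp iexp
  | IMod iexp iexp

type_synonym loc = "string \<times> iexp"

datatype unop = Sqrt | Activation | Activation_Deriv

datatype binop = Plus | Minus | Times | Divide

datatype com =
    Skip
  | Seq com com
  | ISet vname iexp
  | Const loc int
  | Copy loc loc
  | Unary unop loc loc
  | Binary binop loc loc loc
  | If_Le loc loc com com
  | If_ILe iexp iexp com com
  | For vname iexp com

text \<open>\<open>work\<close> counts the real operations executed so far; \<open>used\<close> is the set of all cells in which a
  real number has been stored so far, the input cells included.\<close>

record state =
  idx :: "vname \<Rightarrow> nat"
  mem :: "cell \<Rightarrow> real"
  work :: nat
  used :: "cell set"

primrec ival :: "(vname \<Rightarrow> nat) \<Rightarrow> iexp \<Rightarrow> nat" where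
  "ival \<sigma> (IConst k) = k"
| "ival \<sigma> (IVar v) = \<sigma> v"
| "ival \<sigma> (IAdd a b) = ival \<sigma> a + ival \<sigma> b"
| "ival \<sigma> (ISub a b) = ival \<sigma> a - ival \<sigma> b"
| "ival \<sigma> (IMul a b) = ival \<sigma> a * ival \<sigma> b"
| "ival \<sigma> (IDiv a b) = ival \<sigma> a div ival \<sigma> b"
| "ival \<sigma> (IMod a b) = ival \<sigma> a mod ival \<sigma> b"

definition cell_of :: "state \<Rightarrow> loc \<Rightarrow> cell" where
  "cell_of st p = (fst p, ival (idx st) (snd p))"

definition get :: "loc \<Rightarrow> state \<Rightarrow> real" where
  "get p st = mem st (cell_of st p)"

definition put :: "loc \<Rightarrow> real \<Rightarrow> state \<Rightarrow> state" where
  "put p v st = st\<lparr>mem := (mem st)(cell_of st p := v), used := insert (cell_of st p) (used st)\<rparr>"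

definition tick :: "state \<Rightarrow> state" where
  "tick st = st\<lparr>work := work st + 1\<rparr>"

fun unop_val :: "(real \<Rightarrow> real) \<Rightarrow> unop \<Rightarrow> real \<Rightarrow> real" where
  "unop_val s Sqrt u = sqrt u"
| "unop_val s Activation u = s u"
| "unop_val s Activation_Deriv u = deriv s u"

fun binop_val :: "binop \<Rightarrow> real \<Rightarrow> real \<Rightarrow> real" where
  "binop_val Plus u v = u + v"
| "binop_val Minus u v = u - v"
| "binop_val Times u v = u * v"
| "binop_val Divide u v = u / v"

text \<open>Every arithmetic operation, square root, comparison of reals and evaluation of the activation
  or its derivative counts as one unit of work. Integer constants, data movement and index
  computations are not real operations. The bound of a loop is evaluated once, on entry.\<close>

primrec exec :: "(real \<Rightarrow> real) \<Rightarrow> com \<Rightarrow> state \<Rightarrow> state" where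
  "exec s Skip = (\<lambda>st. st)"
| "exec s (Seq c1 c2) = (\<lambda>st. exec s c2 (exec s c1 st))"
| "exec s (ISet v e) = (\<lambda>st. st\<lparr>idx := (idx st)(v := ival (idx st) e)\<rparr>)"
| "exec s (Const p z) = (\<lambda>st. put p (real_of_int z) st)"
| "exec s (Copy p q) = (\<lambda>st. put p (get q st) st)"
| "exec s (Unary f p q) = (\<lambda>st. tick (put p (unop_val s f (get q st)) st))"
| "exec s (Binary f p q r) = (\<lambda>st. tick (put p (binop_val f (get q st) (get r st)) st))"
| "exec s (If_Le p q c1 c2) =
     (\<lambda>st. if get p st \<le> get q st then exec s c1 (tick st) else exec s c2 (tick st))"
| "exec s (If_ILe a b c1 c2) =
     (\<lambda>st. if ival (idx st) a \<le> ival (idx st) b then exec s c1 st else exec s c2 st)"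
| "exec s (For v e c) =
     (\<lambda>st. fold (\<lambda>i st'. exec s c (st'\<lparr>idx := (idx st')(v := i)\<rparr>)) [0..<ival (idx st) e] st)"

definition run ::
    "(real \<Rightarrow> real) \<Rightarrow> com \<Rightarrow> (vname \<Rightarrow> nat) \<Rightarrow> (cell \<Rightarrow> real) \<Rightarrow> cell set \<Rightarrow> state" where
  "run s c \<sigma> M U = exec s c \<lparr>idx = \<sigma>, mem = M, work = 0, used = U\<rparr>"

text \<open>The operations are total: \<open>u / 0 = 0\<close> and \<open>sqrt (- u) = - sqrt u\<close>. A machine with partial
  operations simulates this one at constant cost, by a comparison before each operation.\<close>

section \<open>Input and output\<close>

definition block :: "string \<Rightarrow> nat \<Rightarrow> cell set" where
  "block a len = {a} \<times> {..<len}"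

definition load :: "string \<Rightarrow> nat \<Rightarrow> (nat \<Rightarrow> real) \<Rightarrow> (cell \<Rightarrow> real) \<Rightarrow> (cell \<Rightarrow> real)" where
  "load a len g M = (\<lambda>(b, j). if b = a \<and> j < len then g j else M (b, j))"

definition sizes :: "nat \<Rightarrow> nat \<Rightarrow> nat \<Rightarrow> vname \<Rightarrow> nat" where
  "sizes d L n = (\<lambda>_. 0)(''d'' := d, ''L'' := L, ''n'' := n)"

text \<open>The precomputation has two stages, because the matrices \<open>Q\<^sub>i\<close> become available only when the
  network outputs are known. The first stage starts from the weights and the data; the second
  one starts from what the first one has stored, together with the \<open>Q\<^sub>i\<close> (column-major). Only the
  real memory is passed on: the index variables are initialized anew.\<close>

definition stage1 ::
    "(real \<Rightarrow> real) \<Rightarrow> com \<Rightarrow> nat \<Rightarrow> nat \<Rightarrow> nat \<Rightarrow> (nat \<Rightarrow> real mat) \<Rightarrow> (nat \<Rightarrow> real vec) \<Rightarrow> state" where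
  "stage1 s c d L n W x =
     run s c (sizes d L n)
       (load ''W'' (d^2 * L) (\<lambda>k. weight_vec d L W $ k)
         (load ''X'' (n * d) (\<lambda>j. x (j div d) $ (j mod d)) (\<lambda>_. 0)))
       (block ''W'' (d^2 * L) \<union> block ''X'' (n * d))"

definition stage2 ::
    "(real \<Rightarrow> real) \<Rightarrow> com \<Rightarrow> nat \<Rightarrow> nat \<Rightarrow> nat \<Rightarrow> (nat \<Rightarrow> real mat) \<Rightarrow> state \<Rightarrow> state" where
  "stage2 s c d L n Q st =
     run s c (sizes d L n)
       (load ''Q'' (n * d^2) (\<lambda>j. Q (j div d^2) $$ (j mod d, j mod d^2 div d)) (mem st))
       (used st \<union> block ''Q'' (n * d^2))"

definition entry_query ::
    "(real \<Rightarrow> real) \<Rightarrow> com \<Rightarrow> nat \<Rightarrow> nat \<Rightarrow> nat \<Rightarrow> nat \<times> nat \<Rightarrow> (cell \<Rightarrow> real) \<Rightarrow> state" where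
  "entry_query s c d L n km M =
     run s c ((sizes d L n)(''k'' := fst km, ''m'' := snd km)) M {}"

text \<open>Queries run one after the other on the same memory.\<close>

definition after_queries ::
    "(real \<Rightarrow> real) \<Rightarrow> com \<Rightarrow> nat \<Rightarrow> nat \<Rightarrow> nat \<Rightarrow> (nat \<times> nat) list \<Rightarrow> (cell \<Rightarrow> real) \<Rightarrow> (cell \<Rightarrow> real)"
  where
  "after_queries s c d L n kms M = fold (\<lambda>km M'. mem (entry_query s c d L n km M')) kms M"

end

theory Submission
  imports Defs
begin

text \<open>Let \<open>B\<^sub>i\<^sub>l\<close> be the Jacobian of the output for data point \<open>i\<close> with respect to the argument of the
  activation in layer \<open>l\<close>. The derivative of the output with respect to entry \<open>(r, c)\<close> of \<open>W\<^sub>l\<close> is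
  column \<open>r\<close> of \<open>B\<^sub>i\<^sub>l\<close> times entry \<open>c\<close> of \<open>x\<^sub>i\<^sup>l\<^sup>-\<^sup>1\<close>, so every Hessian entry is a sum over \<open>i\<close> of an inner
  product of a column of \<open>B\<^sub>i\<^sub>l\<close> with a column of \<open>G\<^sub>i\<^sub>l\<^sub>' = Q\<^sub>i B\<^sub>i\<^sub>l\<^sub>'\<close>, scaled by two inputs. Backpropagation
  yields all \<open>B\<^sub>i\<^sub>l\<close> with one \<open>d \<times> d\<close> matrix product per layer and data point. Storing both \<open>B\<^sub>i\<^sub>l\<close> and
  \<open>G\<^sub>i\<^sub>l\<close>, instead of \<open>R\<^sub>i B\<^sub>i\<^sub>l\<close>, avoids the factorization of \<open>Q\<^sub>i\<close>.\<close>

section \<open>Reasoning about programs\<close>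

text \<open>Frame, work and storage travel in one relation, so that one composition rule serves all
  three: \<open>F\<close> bounds the cells written, and with them the storage, \<open>V\<close> the
  index variables written, \<open>T\<close> the added work.\<close>

definition evolves :: "cell set \<Rightarrow> vname set \<Rightarrow> nat \<Rightarrow> state \<Rightarrow> state \<Rightarrow> bool" where
  "evolves F V T st st' \<longleftrightarrow>
     (\<forall>p. p \<notin> F \<longrightarrow> mem st' p = mem st p) \<and> (\<forall>v. v \<notin> V \<longrightarrow> idx st' v = idx st v) \<and>
     work st' \<le> work st + T \<and> used st' \<subseteq> used st \<union> F"

lemma evolves_mem: "evolves F V T st st' \<Longrightarrow> p \<notin> F \<Longrightarrow> mem st' p = mem st p"
  unfolding evolves_def by blast

lemma evolves_idx: "evolves F V T st st' \<Longrightarrow> v \<notin> V \<Longrightarrow> idx st' v = idx st v"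
  by (simp add: evolves_def)

lemma evolves_work: "evolves F V T st st' \<Longrightarrow> work st' \<le> work st + T"
  by (simp add: evolves_def)

lemma evolves_used: "evolves F V T st st' \<Longrightarrow> used st' \<subseteq> used st \<union> F"
  by (simp add: evolves_def)

lemma evolves_trans:
  assumes "evolves F V T st st'" "evolves F' V' T' st' st''"
  shows "evolves (F \<union> F') (V \<union> V') (T + T') st st''"
  using assms unfolding evolves_def by (fastforce simp: add.assoc)

lemma evolves_mono:
  assumes "evolves F V T st st'" "F \<subseteq> F'" "V \<subseteq> V'" "T \<le> T'"
  shows "evolves F' V' T' st st'"
  using assms unfolding evolves_def by (auto dest: subsetD)

lemma evolves_put:
  "evolves F V T st st' \<Longrightarrow> cell_of st' p \<in> F \<Longrightarrow> evolves F V T st (put p u st')"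
  by (auto simp: evolves_def put_def)

lemma evolves_tick:
  "evolves F V T st st' \<Longrightarrow> evolves F V (Suc T) st (tick st')"
  by (auto simp: evolves_def tick_def)

lemma mem_put [simp]: "mem (put p u st) = (mem st)(cell_of st p := u)"
  and idx_put [simp]: "idx (put p u st) = idx st"
  and mem_tick [simp]: "mem (tick st) = mem st"
  and idx_tick [simp]: "idx (tick st) = idx st"
  by (simp_all add: put_def tick_def)

text \<open>The invariant speaks of the memory alone. What is known of the index variables comes
  from the \<open>evolves\<close> premise of the step, which spans all rounds since loop entry;
  equal round bounds add up to \<open>j * T\<close>.\<close>

lemma For_rule:
  assumes K: "ival (idx st) e = K" and v: "v \<in> V" and init: "I 0 (mem st)"
    and step: "\<And>j st1. j < K \<Longrightarrow> evolves F V (j * T) st st1 \<Longrightarrow> idx st1 v = j \<Longrightarrow> I j (mem st1)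
      \<Longrightarrow> evolves F V T st1 (exec s c st1) \<and> I (Suc j) (mem (exec s c st1))"
  shows "evolves F V (K * T) st (exec s (For v e c) st) \<and> I K (mem (exec s (For v e c) st))"
proof -
  define g where "g k = fold (\<lambda>i st'. exec s c (st'\<lparr>idx := (idx st')(v := i)\<rparr>)) [0..<k] st" for k
  have "evolves F V (k * T) st (g k) \<and> I k (mem (g k))" if "k \<le> K" for k
    using that
  proof (induction k)
    case 0
    then show ?case using init by (simp add: g_def evolves_def)
  next
    case (Suc k)
    let ?st1 = "(g k)\<lparr>idx := (idx (g k))(v := k)\<rparr>"
    have IH: "evolves F V (k * T) st (g k)" "I k (mem (g k))" using Suc by auto
    have 1: "evolves F V (k * T) st ?st1" using IH(1) v by (auto simp: evolves_def)
    have 2: "evolves F V T ?st1 (exec s c ?st1) \<and> I (Suc k) (mem (exec s c ?st1))"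
      using step[of k ?st1] Suc.prems 1 IH(2) by simp
    then show ?case
      using evolves_trans[OF 1, of F V T "exec s c ?st1"] by (simp add: g_def add.commute)
  qed
  from this[of K] show ?thesis by (simp add: g_def K)
qed

abbreviation acc :: loc where "acc \<equiv> (''acc'', IConst 0)"

abbreviation scratch :: "cell set" where "scratch \<equiv> {(''acc'', 0), (''t'', 0)}"

text \<open>The subscripts of \<open>p\<close> and \<open>q\<close> may mention
  \<open>''r''\<close>, which is how a row or a column is traversed. Zeroing \<open>acc\<close> is
  free, each round costs two operations.\<close>

definition dot :: "iexp \<Rightarrow> loc \<Rightarrow> loc \<Rightarrow> com" where
  "dot e p q = Seq (Const acc 0) (For ''r'' e
     (Seq (Binary Times (''t'', IConst 0) p q) (Binary Plus acc acc (''t'', IConst 0))))"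

text \<open>All factors can be read off the initial memory, because the loop overwrites only the two
  scratch cells and the operands lie in other arrays.\<close>

lemma exec_dot:
  assumes p: "fst p \<notin> {''acc'', ''t''}" and q: "fst q \<notin> {''acc'', ''t''}"
    and K: "ival (idx st) e = K"
  shows "evolves scratch {''r''} (2 * K) st (exec s (dot e p q) st)"
    and "mem (exec s (dot e p q) st) (''acc'', 0) =
      (\<Sum>j<K. mem st (fst p, ival ((idx st)(''r'' := j)) (snd p)) *
             mem st (fst q, ival ((idx st)(''r'' := j)) (snd q)))"
proof -
  let ?term = "\<lambda>j. mem st (fst p, ival ((idx st)(''r'' := j)) (snd p)) *
             mem st (fst q, ival ((idx st)(''r'' := j)) (snd q))"
  let ?c = "Seq (Binary Times (''t'', IConst 0) p q) (Binary Plus acc acc (''t'', IConst 0))"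
  let ?st = "put acc 0 st"
  have start: "evolves scratch {''r''} 0 st ?st"
    by (auto simp: evolves_def put_def cell_of_def)
  have "evolves scratch {''r''} (K * 2) ?st (exec s (For ''r'' e ?c) ?st) \<and>
    mem (exec s (For ''r'' e ?c) ?st) (''acc'', 0) = (\<Sum>j<K. ?term j)"
  proof (rule For_rule[where I = "\<lambda>j M. M (''acc'', 0) = (\<Sum>j<j. ?term j)"])
    fix j st1
    assume ev: "evolves scratch {''r''} (j * 2) ?st st1" and j: "idx st1 ''r'' = j"
      and I: "mem st1 (''acc'', 0) = (\<Sum>j<j. ?term j)"
    have ix: "idx st1 = (idx st)(''r'' := j)"
      using evolves_idx[OF ev] j by (auto simp: fun_eq_iff)
    have m: "mem st1 c = mem st c" if "fst c \<notin> {''acc'', ''t''}" for c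
      using evolves_mem[OF ev, of c] that by (cases c) (auto simp: cell_of_def)
    have "get p st1 * get q st1 = ?term j"
      using p q by (simp add: get_def cell_of_def ix m)
    then show "evolves scratch {''r''} 2 st1 (exec s ?c st1) \<and>
        mem (exec s ?c st1) (''acc'', 0) = (\<Sum>j<Suc j. ?term j)"
      using I by (auto simp: evolves_def put_def tick_def get_def cell_of_def)
  qed (simp_all add: K cell_of_def)
  then show "evolves scratch {''r''} (2 * K) st (exec s (dot e p q) st)"
    and "mem (exec s (dot e p q) st) (''acc'', 0) = (\<Sum>j<K. ?term j)"
    using evolves_trans[OF start, of scratch "{''r''}" "K * 2"]
    by (auto simp: dot_def mult.commute)
qed

lemma mult_add_less:
  fixes i A B r :: nat
  assumes "i < A" "r < B"
  shows "i * B + r < A * B"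
proof -
  have "i * B + r < Suc i * B" using assms by simp
  also have "\<dots> \<le> A * B" using assms by (intro mult_right_mono) auto
  finally show ?thesis .
qed

section \<open>The Jacobian by backpropagation\<close>

locale mlp =
  fixes s :: "real \<Rightarrow> real" and d L :: nat and W :: "nat \<Rightarrow> real mat"
  assumes s_diff: "s differentiable (at u)"
    and W_dim: "\<And>l. l \<in> {1..L} \<Longrightarrow> W l \<in> carrier_mat d d"
begin

text \<open>Meaningful for \<open>l \<ge> 1\<close> only, as there is no activation in layer
  0.\<close>

definition slope :: "real vec \<Rightarrow> nat \<Rightarrow> nat \<Rightarrow> real" where
  "slope z l r = deriv s ((W l *\<^sub>v forward s W z (l - 1)) $ r)"

text \<open>\<open>backprop z b a c\<close> is the derivative of the output \<open>x\<^sup>L\<close> in entry \<open>a\<close> with respect to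
  entry \<open>c\<close> of the argument of the activation in layer \<open>L - b\<close>.\<close>

fun backprop :: "real vec \<Rightarrow> nat \<Rightarrow> nat \<Rightarrow> nat \<Rightarrow> real" where
  "backprop z 0 a c = (if a = c then 1 else 0) * slope z L c"
| "backprop z (Suc b) a c =
     (\<Sum>r<d. backprop z b a r * W (L - b) $$ (r, c)) * slope z (L - Suc b) c"

text \<open>Stated for arbitrary weights \<open>W'\<close>, because differentiation needs it for
  weights with one perturbed entry.\<close>

lemma forward_dim:
  assumes "z \<in> carrier_vec d" "l \<le> L" "\<And>l. l \<in> {1..L} \<Longrightarrow> W' l \<in> carrier_mat d d"
  shows "forward s W' z l \<in> carrier_vec d"
  using assms(1,2)
proof (induction l)
  case (Suc l)
  then show ?case using assms(3)[of "Suc l"] by (auto intro!: mult_mat_vec_carrier)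
qed simp

lemma mult_forward:
  assumes "z \<in> carrier_vec d" "l < L" "\<And>l. l \<in> {1..L} \<Longrightarrow> W' l \<in> carrier_mat d d" "r < d"
  shows "(W' (Suc l) *\<^sub>v forward s W' z l) $ r =
    (\<Sum>c<d. W' (Suc l) $$ (r, c) * forward s W' z l $ c)"
proof -
  have "W' (Suc l) \<in> carrier_mat d d" "forward s W' z l \<in> carrier_vec d"
    using assms forward_dim[OF assms(1) _ assms(3)] by auto
  then show ?thesis using assms(4) by (simp add: scalar_prod_def atLeast0LessThan)
qed

lemma forward_Suc:
  assumes "z \<in> carrier_vec d" "l < L" "\<And>l. l \<in> {1..L} \<Longrightarrow> W' l \<in> carrier_mat d d" "r < d"
  shows "forward s W' z (Suc l) $ r = s ((W' (Suc l) *\<^sub>v forward s W' z l) $ r)"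
proof -
  have "W' (Suc l) \<in> carrier_mat d d" using assms by simp
  then show ?thesis using assms(4) by simp
qed

text \<open>The column-major position in Horner form, with layers counted from 0: repeated division
  by \<open>d\<close> returns \<open>r\<close>, \<open>c\<close> and \<open>l\<close>.\<close>

lemma weight_vec_index:
  assumes "l < L" "c < d" "r < d"
  shows "weight_vec d L W $ ((l * d + c) * d + r) = W (Suc l) $$ (r, c)"
proof -
  have "layer_weights d (weight_vec d L W) (Suc l) $$ (r, c) = W (Suc l) $$ (r, c)"
    using layer_weights_weight_vec[of W "Suc l" d L] W_dim assms by auto
  then show ?thesis using assms
    by (simp add: layer_weights_def power2_eq_square algebra_simps)
qed

lemma weight_index_less:
  assumes "l < L" "c < d" "r < d"
  shows "(l * d + c) * d + r < d\<^sup>2 * L"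
  using mult_add_less[OF mult_add_less[OF assms(1,2)] assms(3)]
  by (simp add: power2_eq_square algebra_simps)

text \<open>Derivatives of the preactivations are pushed forward from layer \<open>Suc l\<close> to
  layer \<open>L\<close>. Their pairing with \<open>backprop\<close> is the same at every layer, and
  at the last one it is the derivative of the output.\<close>

lemma has_derivative_output:
  assumes z: "z \<in> carrier_vec d" and l: "l < L" and c: "c < d" and r: "r < d" and a: "a < d"
  defines "w \<equiv> weight_vec d L W" and "m \<equiv> (l * d + c) * d + r"
  shows "((\<lambda>t. forward s (layer_weights d (w |\<^sub>v m \<mapsto> t)) z L $ a) has_field_derivative
    backprop z (L - Suc l) a r * forward s W z l $ c) (at (w $ m))"
proof -
  define V where "V t = layer_weights d (w |\<^sub>v m \<mapsto> t)" for t
  have V_dim: "V t k \<in> carrier_mat d d" for t k by (simp add: V_def layer_weights_def)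
  have m_less: "m < dim_vec w"
    using weight_index_less[OF l c r] by (simp add: m_def w_def weight_vec_def)
  \<comment> \<open>Varying coordinate \<open>m\<close> moves one entry of one matrix, since a
    position determines layer, column and row.\<close>
  have V_index: "V t (Suc k) $$ (r', c') =
      (if k = l \<and> c' = c \<and> r' = r then t else W (Suc k) $$ (r', c'))"
    if "k < L" "c' < d" "r' < d" for t k r' c'
  proof -
    have "V t (Suc k) $$ (r', c') = (w |\<^sub>v m \<mapsto> t) $ ((k * d + c') * d + r')"
      using that by (simp add: V_def layer_weights_def power2_eq_square algebra_simps)
    moreover have "(k * d + c') * d + r' < dim_vec w"
      using weight_index_less[of k c' r'] that by (simp add: w_def weight_vec_def)
    moreover have "(k * d + c') * d + r' = m \<longleftrightarrow> k = l \<and> c' = c \<and> r' = r"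
    proof
      assume eq: "(k * d + c') * d + r' = m"
      from arg_cong[OF eq, of "\<lambda>x. x mod d"] have "r' = r" using r that by (simp add: m_def)
      moreover from arg_cong[OF eq, of "\<lambda>x. x div d mod d"] have "c' = c"
        using r c that by (simp add: m_def)
      moreover from arg_cong[OF eq, of "\<lambda>x. x div d div d"] have "k = l"
        using r c that by (simp add: m_def)
      ultimately show "k = l \<and> c' = c \<and> r' = r" by simp
    qed (simp add: m_def)
    ultimately show ?thesis using weight_vec_index[OF that] m_less
      by (cases "k = l \<and> c' = c \<and> r' = r") (auto simp: w_def)
  qed
  have V_at: "V (w $ m) k = W k" if "k \<in> {1..L}" for k
  proof -
    have "w |\<^sub>v m \<mapsto> w $ m = w" by (intro eq_vecI) (auto simp: update_vec_def)
    then show ?thesis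
      using layer_weights_weight_vec[of W k d L] W_dim[OF that] that by (simp add: V_def w_def)
  qed
  \<comment> \<open>Activations up to layer \<open>k\<close> see only the weights up to layer
    \<open>k\<close>. This serves at the base point and, for every \<open>t\<close>, below the
    perturbed layer.\<close>
  have same: "forward s (V t) z k = forward s W z k"
    if "k \<le> L" "\<forall>j\<in>{1..k}. V t j = W j" for k t
    using that
  proof (induction k)
    case (Suc k)
    then show ?case by simp
  qed simp
  define pre where "pre t k e = (V t k *\<^sub>v forward s (V t) z (k - 1)) $ e" for t k e
  have slope_eq: "deriv s (pre (w $ m) k e) = slope z k e" if "k \<in> {1..L}" for k e
    using same[of "k - 1" "w $ m"] V_at that by (auto simp: pre_def slope_def)
  \<comment> \<open>The induction invariant: \<open>u\<close> is the derivative of the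
    preactivations of layer \<open>k\<close>, and its pairing with each row of
    \<open>backprop z (L - k)\<close> has a value free of \<open>k\<close>.\<close>
  have "\<exists>u. (\<forall>e<d. ((\<lambda>t. pre t k e) has_field_derivative u e) (at (w $ m))) \<and>
      (\<forall>a<d. (\<Sum>e<d. backprop z (L - k) a e * u e) =
        backprop z (L - Suc l) a r * forward s W z l $ c)"
    if "Suc l \<le> k" "k \<le> L" for k
    using that
  proof (induction k rule: dec_induct)
    case base
    \<comment> \<open>Only preactivation \<open>r\<close> of layer \<open>Suc l\<close> depends on
      \<open>t\<close>, with activation \<open>c\<close> of the layer below as coefficient.\<close>
    define u where "u e = (if e = r then forward s W z l $ c else 0)" for e
    have fl: "forward s (V t) z l = forward s W z l" for t
    proof (rule same)
      show "\<forall>j\<in>{1..l}. V t j = W j"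
      proof
        fix j assume j: "j \<in> {1..l}"
        then obtain k where k: "j = Suc k" "k < l" by (cases j) auto
        show "V t j = W j"
          using V_dim[of t j] W_dim[of j] V_index[of k _ _ t] k l by (intro eq_matI) auto
      qed
    qed (use l in simp)
    have pre_eq: "pre t (Suc l) e = (\<Sum>c'<d. V t (Suc l) $$ (e, c') * forward s W z l $ c')"
      if "e < d" for t e
      using mult_forward[where W' = "V t", OF z l V_dim that] by (simp add: pre_def fl)
    have "((\<lambda>t. pre t (Suc l) e) has_field_derivative u e) (at (w $ m))" if e: "e < d" for e
    proof -
      have "((\<lambda>t. \<Sum>c'<d. V t (Suc l) $$ (e, c') * forward s W z l $ c')
        has_field_derivative (\<Sum>c'<d. if c' = c then u e else 0)) (at (w $ m))"
      proof (rule DERIV_sum)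
        fix c' assume "c' \<in> {..<d}"
        then show "((\<lambda>t. V t (Suc l) $$ (e, c') * forward s W z l $ c') has_field_derivative
            (if c' = c then u e else 0)) (at (w $ m))"
          using l e by (auto simp: V_index u_def intro!: derivative_eq_intros)
      qed
      then show ?thesis using c by (simp add: pre_eq[OF e])
    qed
    moreover have "(\<Sum>e<d. backprop z (L - Suc l) a e * u e) =
        backprop z (L - Suc l) a r * forward s W z l $ c" for a
    proof -
      have "(\<Sum>e<d. backprop z (L - Suc l) a e * u e) =
        (\<Sum>e<d. if e = r then backprop z (L - Suc l) a r * forward s W z l $ c else 0)"
        by (intro sum.cong) (auto simp: u_def)
      then show ?thesis using r by simp
    qed
    ultimately show ?case by blast
  next
    case (step k)
    then obtain u where u: "\<And>e. e < d \<Longrightarrow> ((\<lambda>t. pre t k e) has_field_derivative u e) (at (w $ m))"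
      and sum_u: "\<And>a. a < d \<Longrightarrow> (\<Sum>e<d. backprop z (L - k) a e * u e) =
        backprop z (L - Suc l) a r * forward s W z l $ c" by auto
    \<comment> \<open>Chain rule: through the activation of layer \<open>k\<close>, then linearly
      through \<open>W (Suc k)\<close>, which does not vary with \<open>t\<close> because
      \<open>k > l\<close>.\<close>
    define u' where "u' e = (\<Sum>e'<d. W (Suc k) $$ (e, e') * (slope z k e' * u e'))" for e
    have k: "0 < k" "k < L" "l < k" using step by auto
    have "((\<lambda>t. pre t (Suc k) e) has_field_derivative u' e) (at (w $ m))" if e: "e < d" for e
    proof -
      have pre_eq: "pre t (Suc k) e = (\<Sum>e'<d. W (Suc k) $$ (e, e') * s (pre t k e'))" for t
      proof -
        have "pre t (Suc k) e = (\<Sum>e'<d. V t (Suc k) $$ (e, e') * forward s (V t) z k $ e')"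
          using mult_forward[where W' = "V t", OF z k(2) V_dim e] by (simp add: pre_def)
        also have "\<dots> = (\<Sum>e'<d. W (Suc k) $$ (e, e') * s (pre t k e'))"
        proof (intro sum.cong refl)
          fix e' assume e': "e' \<in> {..<d}"
          have "forward s (V t) z (Suc (k - 1)) $ e' = s (pre t k e')"
            using forward_Suc[where W' = "V t" and l = "k - 1" and r = e', OF z _ V_dim] e' k by (simp add: pre_def)
          then show "V t (Suc k) $$ (e, e') * forward s (V t) z k $ e' =
              W (Suc k) $$ (e, e') * s (pre t k e')"
            using e e' k by (simp add: V_index)
        qed
        finally show ?thesis .
      qed
      have "((\<lambda>t. s (pre t k e')) has_field_derivative slope z k e' * u e') (at (w $ m))"
        if "e' < d" for e'
      proof -
        have "(s has_field_derivative deriv s (pre (w $ m) k e')) (at (pre (w $ m) k e'))"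
          using s_diff by (simp add: DERIV_deriv_iff_real_differentiable)
        then have "(s has_field_derivative slope z k e') (at (pre (w $ m) k e'))"
          using slope_eq[of k e'] k by simp
        from DERIV_chain2[OF this u[OF that]] show ?thesis .
      qed
      then show ?thesis unfolding pre_eq u'_def
        by (intro DERIV_sum DERIV_cmult) auto
    qed
    moreover have "(\<Sum>e<d. backprop z (L - Suc k) a e * u' e) =
        backprop z (L - Suc l) a r * forward s W z l $ c" if "a < d" for a
    proof -
      \<comment> \<open>Written as a successor, \<open>L - k\<close> unfolds one step of
        \<open>backprop\<close>, and the matrix index \<open>L - b\<close> becomes
        \<open>Suc k\<close>. Exchanging the sums then moves the matrix from \<open>u'\<close> to
        \<open>backprop\<close>.\<close>
      have Lk: "L - k = Suc (L - Suc k)" "L - (L - Suc k) = Suc k" "L - Suc (L - Suc k) = k"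
        using k by auto
      have "(\<Sum>e<d. backprop z (L - Suc k) a e * u' e) = (\<Sum>e<d. \<Sum>e'<d.
          backprop z (L - Suc k) a e * W (Suc k) $$ (e, e') * slope z k e' * u e')"
        by (simp add: u'_def sum_distrib_left mult.assoc)
      also have "\<dots> = (\<Sum>e'<d. \<Sum>e<d.
          backprop z (L - Suc k) a e * W (Suc k) $$ (e, e') * slope z k e' * u e')"
        by (rule sum.swap)
      also have "\<dots> = (\<Sum>e'<d. backprop z (L - k) a e' * u e')"
        unfolding Lk(1) backprop.simps Lk(2,3) by (simp add: sum_distrib_right)
      finally show ?thesis using sum_u[OF that] by simp
    qed
    ultimately show ?case by blast
  qed
  from this[of L] l obtain u where
    u: "\<And>e. e < d \<Longrightarrow> ((\<lambda>t. pre t L e) has_field_derivative u e) (at (w $ m))"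
    and sum_u: "(\<Sum>e<d. backprop z 0 a e * u e) =
      backprop z (L - Suc l) a r * forward s W z l $ c" using a by auto
  \<comment> \<open>\<open>backprop z 0\<close> is diagonal, so the pairing collapses to the one
    term that the chain rule for the last activation produces.\<close>
  have "(\<Sum>e<d. backprop z 0 a e * u e) = (\<Sum>e<d. if e = a then slope z L a * u a else 0)"
    by (intro sum.cong) auto
  then have slope_u: "slope z L a * u a = backprop z (L - Suc l) a r * forward s W z l $ c"
    using sum_u a by simp
  have "((\<lambda>t. s (pre t L a)) has_field_derivative slope z L a * u a) (at (w $ m))"
  proof -
    have "(s has_field_derivative deriv s (pre (w $ m) L a)) (at (pre (w $ m) L a))"
      using s_diff by (simp add: DERIV_deriv_iff_real_differentiable)
    then have "(s has_field_derivative slope z L a) (at (pre (w $ m) L a))"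
      using slope_eq[of L a] l by simp
    from DERIV_chain2[OF this u[OF a]] show ?thesis .
  qed
  moreover have "forward s (V t) z L $ a = s (pre t L a)" for t
    using forward_Suc[where W' = "V t" and l = "L - 1", OF z _ V_dim a] l by (simp add: pre_def)
  ultimately show ?thesis by (simp add: slope_u V_def)
qed

lemma output_jacobian_index:
  assumes "z \<in> carrier_vec d" "l < L" "c < d" "r < d" "a < d"
  shows "output_jacobian s d L W z $$ (a, (l * d + c) * d + r) =
    backprop z (L - Suc l) a r * forward s W z l $ c"
  using has_derivative_output[OF assms] weight_index_less[OF assms(2-4)] assms(5)
  by (simp add: output_jacobian_def partial_deriv_def DERIV_imp_deriv)

end

section \<open>The programs\<close>

abbreviation vd :: iexp where "vd \<equiv> IVar ''d''"
abbreviation vL :: iexp where "vL \<equiv> IVar ''L''"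
abbreviation vn :: iexp where "vn \<equiv> IVar ''n''"
abbreviation vj :: iexp where "vj \<equiv> IVar ''j''"
abbreviation vr :: iexp where "vr \<equiv> IVar ''r''"

text \<open>Arrays are laid out by the major index first, and \<open>flat B a b\<close> is the position \<open>a B + b\<close>. The
  digits of a position are recovered by \<open>div\<close> and \<open>mod\<close>, so that one loop fills a whole array.\<close>

abbreviation flat :: "iexp \<Rightarrow> iexp \<Rightarrow> iexp \<Rightarrow> iexp" where
  "flat B a b \<equiv> IAdd (IMul a B) b"

text \<open>Position \<open>(l n + i) d + r\<close> of \<open>x\<close> holds entry \<open>r\<close> of layer \<open>l\<close> for data point \<open>i\<close>, and that of
  \<open>D\<close> the derivative of the activation there (for \<open>l \<ge> 1\<close>).\<close>

definition forward_prog :: com where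
  "forward_prog = Seq
     (For ''j'' (IMul (IMul (IAdd vL (IConst (Suc 0))) vn) vd)
       (If_ILe (IConst (Suc 0)) (IDiv (IDiv vj vd) vn)
         (Seq
           (dot vd
             (''W'', flat vd (flat vd (ISub (IDiv (IDiv vj vd) vn) (IConst (Suc 0))) vr) (IMod vj vd))
             (''x'', flat vd (ISub (IDiv vj vd) vn) vr))
           (Seq (Unary Activation (''x'', vj) acc) (Unary Activation_Deriv (''D'', vj) acc)))
         (Copy (''x'', vj) (''X'', vj))))
     (For ''j'' (IMul vn vd) (Copy (''out'', vj) (''x'', flat (IMul vn vd) vL vj)))"

text \<open>Position \<open>((b n + i) d + a) d + c\<close> of \<open>B\<close> holds \<open>backprop (x i) b a c\<close>, and that of \<open>G\<close> the
  entry \<open>(a, c)\<close> of the product of \<open>Q\<^sub>i\<close> with that matrix.\<close>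

definition backward_prog :: com where
  "backward_prog =
     For ''j'' (IMul (IMul (IMul vL vn) vd) vd)
       (Seq
         (If_ILe (IConst (Suc 0)) (IDiv (IDiv (IDiv vj vd) vd) vn)
           (dot vd
             (''B'', flat vd (ISub (IDiv vj vd) (IMul vn vd)) vr)
             (''W'', flat vd
               (flat vd (ISub vL (IDiv (IDiv (IDiv vj vd) vd) vn)) (IMod vj vd)) vr))
           (If_ILe (IMod (IDiv vj vd) vd) (IMod vj vd)
             (If_ILe (IMod vj vd) (IMod (IDiv vj vd) vd) (Const acc 1) (Const acc 0))
             (Const acc 0)))
         (Binary Times (''B'', vj) acc
           (''D'', flat vd
             (flat vn (ISub vL (IDiv (IDiv (IDiv vj vd) vd) vn)) (IMod (IDiv (IDiv vj vd) vd) vn))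
             (IMod vj vd))))"

definition loss_prog :: com where
  "loss_prog =
     For ''j'' (IMul (IMul (IMul vL vn) vd) vd)
       (Seq
         (dot vd
           (''Q'', flat vd (flat vd (IMod (IDiv (IDiv vj vd) vd) vn) vr) (IMod (IDiv vj vd) vd))
           (''B'', flat vd (flat vd (IDiv (IDiv vj vd) vd) vr) (IMod vj vd)))
         (Copy (''G'', vj) acc))"

text \<open>\<open>backprop\<close> numbers layers from the output, hence \<open>L - (l + 1)\<close>
  for layer \<open>l\<close> counted from 0. \<open>''j''\<close> is the data point, and
  \<open>''r''\<close>, the variable of \<open>dot\<close>, walks down the column given by the row
  digit of the weight.\<close>

definition column :: "vname \<Rightarrow> iexp" where
  "column v = flat vd
     (flat vd (flat vn (ISub vL (IAdd (IDiv (IDiv (IVar v) vd) vd) (IConst (Suc 0)))) vj) vr)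
     (IMod (IVar v) vd)"

text \<open>No shift here: the weights of layer \<open>l\<close> counted from 0 act on the
  activations stored under \<open>l\<close>.\<close>

definition input_entry :: "vname \<Rightarrow> iexp" where
  "input_entry v = flat vd (flat vn (IDiv (IDiv (IVar v) vd) vd) vj) (IMod (IDiv (IVar v) vd) vd)"

definition entry_prog :: com where
  "entry_prog = Seq (Const (''H'', IConst 0) 0)
     (For ''j'' vn
       (Seq (dot vd (''B'', column ''k'') (''G'', column ''m''))
       (Seq (Binary Times acc acc (''x'', input_entry ''k''))
       (Seq (Binary Times acc acc (''x'', input_entry ''m''))
            (Binary Plus (''H'', IConst 0) (''H'', IConst 0) acc)))))"

section \<open>Correctness and cost of the programs\<close>

locale dataset = mlp +
  fixes n :: nat and x :: "nat \<Rightarrow> real vec"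
  assumes pos: "0 < d" "0 < L" "0 < n"
    and x_dim: "\<And>i. i < n \<Longrightarrow> x i \<in> carrier_vec d"
begin

text \<open>This and the next three definitions give the intended content of an array as a function
  of the bare position, so that a loop invariant only quantifies over the positions below the
  counter.\<close>

definition act_at :: "nat \<Rightarrow> real" where
  "act_at j = forward s W (x (j div d mod n)) (j div d div n) $ (j mod d)"

definition slope_at :: "nat \<Rightarrow> real" where
  "slope_at j = slope (x (j div d mod n)) (j div d div n) (j mod d)"

definition backprop_at :: "nat \<Rightarrow> real" where
  "backprop_at j = backprop (x (j div d div d mod n)) (j div d div d div n) (j div d mod d) (j mod d)"

definition loss_at :: "(nat \<Rightarrow> real mat) \<Rightarrow> nat \<Rightarrow> real" where
  "loss_at Q j = (\<Sum>r<d. Q (j div d div d mod n) $$ (j div d mod d, r) *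
     backprop (x (j div d div d mod n)) (j div d div d div n) r (j mod d))"

lemma decode_layer:
  assumes "j < A * n * d"
  obtains l i r where "l < A" "i < n" "r < d" "j = (l * n + i) * d + r"
proof (rule that)
  show "j div d div n < A"
    using assms by (simp add: less_mult_imp_div_less)
  show "j = (j div d div n * n + j div d mod n) * d + j mod d"
    by simp
qed (use pos in simp_all)

text \<open>The counter passes layer after layer, so each sum reads only entries of \<open>x\<close>
  from earlier rounds. A round costs \<open>2 * d\<close> for the sum and two for the activation and
  its derivative; layer 0 is a free copy that leaves \<open>D\<close> unset, whence the guard on
  \<open>D\<close>.\<close>

lemma forward_prog_correct:
  assumes d: "idx st ''d'' = d" and L: "idx st ''L'' = L" and n: "idx st ''n'' = n"
    and W: "\<And>k. k < d^2 * L \<Longrightarrow> mem st (''W'', k) = weight_vec d L W $ k"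
    and X: "\<And>j. j < n * d \<Longrightarrow> mem st (''X'', j) = x (j div d) $ (j mod d)"
  defines "K \<equiv> (L + 1) * n * d"
  shows "evolves (block ''x'' K \<union> block ''D'' K \<union> block ''out'' (n * d) \<union> scratch) {''j'', ''r''}
      (K * (2 * d + 2)) st (exec s forward_prog st)" (is ?ev)
    and "\<forall>j<K. mem (exec s forward_prog st) (''x'', j) = act_at j \<and>
      (1 \<le> j div d div n \<longrightarrow> mem (exec s forward_prog st) (''D'', j) = slope_at j)" (is ?act)
    and "\<forall>j<n * d. mem (exec s forward_prog st) (''out'', j) = act_at (L * n * d + j)" (is ?out)
proof -
  let ?F = "block ''x'' K \<union> block ''D'' K \<union> scratch" and ?V = "{''j'', ''r''}"
  let ?p = "(''W'', flat vd (flat vd (ISub (IDiv (IDiv vj vd) vn) (IConst (Suc 0))) vr) (IMod vj vd))"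
    and ?q = "(''x'', flat vd (ISub (IDiv vj vd) vn) vr)"
  let ?store = "Seq (Unary Activation (''x'', vj) acc) (Unary Activation_Deriv (''D'', vj) acc)"
  let ?c = "If_ILe (IConst (Suc 0)) (IDiv (IDiv vj vd) vn) (Seq (dot vd ?p ?q) ?store)
    (Copy (''x'', vj) (''X'', vj))"
  let ?I = "\<lambda>J M. \<forall>j<J. M (''x'', j) = act_at j \<and> (1 \<le> j div d div n \<longrightarrow> M (''D'', j) = slope_at j)"
  let ?loop = "For ''j'' (IMul (IMul (IAdd vL (IConst (Suc 0))) vn) vd) ?c"
  have 1: "evolves ?F ?V (K * (2 * d + 2)) st (exec s ?loop st) \<and> ?I K (mem (exec s ?loop st))"
  proof (rule For_rule[where I = ?I])
    fix j st1
    assume j: "j < K" and ev: "evolves ?F ?V (j * (2 * d + 2)) st st1" and ix: "idx st1 ''j'' = j"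
      and I: "?I j (mem st1)"
    have [simp]: "idx st1 ''d'' = d" "idx st1 ''L'' = L" "idx st1 ''n'' = n"
      using evolves_idx[OF ev] d L n by auto
    obtain l i r where l: "l < L + 1" and i: "i < n" and r: "r < d" and j_eq: "j = (l * n + i) * d + r"
      using decode_layer j unfolding K_def by blast
    have dig: "j div d = l * n + i" "j mod d = r" "(l * n + i) div n = l" "(l * n + i) mod n = i"
      using i r by (simp_all add: j_eq)
    have at: "act_at j = forward s W (x i) l $ r" "slope_at j = slope (x i) l r"
      by (simp_all only: act_at_def slope_at_def dig)
    show "evolves ?F ?V (2 * d + 2) st1 (exec s ?c st1) \<and> ?I (Suc j) (mem (exec s ?c st1))"
    proof (cases l)
      case 0
      have jnd: "j < n * d" using mult_add_less[OF i r] by (simp add: j_eq 0)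
      have exec: "exec s ?c st1 = put (''x'', vj) (get (''X'', vj) st1) st1"
        using dig 0 by (simp add: ix)
      have "mem st1 (''X'', j) = act_at j"
        using evolves_mem[OF ev, of "(''X'', j)"] X[OF jnd] dig i 0
        by (simp add: block_def act_at_def)
      then have "?I (Suc j) (mem (exec s ?c st1))"
        using I dig 0 unfolding exec by (auto simp: get_def cell_of_def ix less_Suc_eq)
      moreover have "evolves ?F ?V (2 * d + 2) st1 (exec s ?c st1)"
        unfolding exec using j by (intro evolves_put) (auto simp: evolves_def cell_of_def ix block_def)
      ultimately show ?thesis by simp
    next
      case (Suc l')
      let ?st2 = "exec s (dot vd ?p ?q) st1"
      have exec: "exec s ?c st1 = exec s ?store ?st2"
        using dig Suc by (simp add: ix)
      have ev2: "evolves scratch {''r''} (2 * d) st1 ?st2"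
        by (rule exec_dot) simp_all
      have ix2: "idx ?st2 ''j'' = j" using evolves_idx[OF ev2] ix by simp
      have summand: "mem st1 (''W'', (l' * d + c) * d + r) = W l $$ (r, c)"
        "mem st1 (''x'', (l' * n + i) * d + c) = forward s W (x i) l' $ c" if c: "c < d" for c
      proof -
        show "mem st1 (''W'', (l' * d + c) * d + r) = W l $$ (r, c)"
          using evolves_mem[OF ev, of "(''W'', (l' * d + c) * d + r)"] W[OF weight_index_less]
            weight_vec_index l r c Suc by (simp add: block_def)
        \<comment> \<open>One layer down is \<open>n\<close> rows of length \<open>d\<close> back;
          as \<open>n > 0\<close>, the whole row being read ends before position
          \<open>j\<close>.\<close>
        have "(l' * n + i) * d + c < (l' * n + i + 1) * d" using c by simp
        also have "\<dots> \<le> (l * n + i) * d" unfolding Suc using pos by (intro mult_right_mono) auto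
        finally have "(l' * n + i) * d + c < j" by (simp add: j_eq)
        then show "mem st1 (''x'', (l' * n + i) * d + c) = forward s W (x i) l' $ c"
          using I i c by (simp add: act_at_def)
      qed
      have "mem ?st2 (''acc'', 0) = (\<Sum>c<d. mem st1 (''W'', (l' * d + c) * d + r) *
          mem st1 (''x'', (l' * n + i) * d + c))"
        by (subst exec_dot(2)[where K = d]) (use dig Suc in \<open>simp_all add: ix\<close>)
      also have "\<dots> = (\<Sum>c<d. W l $$ (r, c) * forward s W (x i) l' $ c)"
        by (intro sum.cong refl) (simp add: summand)
      also have "\<dots> = (W l *\<^sub>v forward s W (x i) l') $ r"
        using mult_forward[where W' = W and l = l', OF x_dim[OF i] _ W_dim r] l Suc by simp
      finally have accv: "mem ?st2 (''acc'', 0) = (W l *\<^sub>v forward s W (x i) l') $ r" .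
      have mem3: "mem (exec s ?store ?st2) = (mem ?st2)(
          (''x'', j) := s (mem ?st2 (''acc'', 0)), (''D'', j) := deriv s (mem ?st2 (''acc'', 0)))"
        by (simp add: cell_of_def get_def ix2)
      have "mem ?st2 (''x'', j') = mem st1 (''x'', j')" "mem ?st2 (''D'', j') = mem st1 (''D'', j')" for j'
        by (rule evolves_mem[OF ev2], simp)+
      moreover have "s (mem ?st2 (''acc'', 0)) = act_at j" "deriv s (mem ?st2 (''acc'', 0)) = slope_at j"
        using forward_Suc[where W' = W and l = l', OF x_dim[OF i] _ W_dim r] l
        by (simp_all add: accv at slope_def Suc)
      ultimately have "?I (Suc j) (mem (exec s ?c st1))"
        using I unfolding exec mem3 by (auto simp: less_Suc_eq)
      moreover have "evolves ?F ?V (Suc (Suc (2 * d))) st1 (exec s ?store ?st2)"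
        unfolding exec.simps
        by (intro evolves_tick evolves_put evolves_mono[OF ev2])
          (use j in \<open>auto simp: cell_of_def ix2 block_def\<close>)
      ultimately show ?thesis unfolding exec by simp
    qed
  qed (simp_all add: d L n K_def)
  let ?st1 = "exec s ?loop st"
  let ?c2 = "Copy (''out'', vj) (''x'', flat (IMul vn vd) vL vj)"
  have [simp]: "idx ?st1 ''d'' = d" "idx ?st1 ''L'' = L" "idx ?st1 ''n'' = n"
    using evolves_idx[OF conjunct1[OF 1]] d L n by (auto simp del: exec.simps)
  \<comment> \<open>Copying is not a real operation, hence the round bound 0.\<close>
  have 2: "evolves (block ''out'' (n * d)) {''j''} (n * d * 0) ?st1
      (exec s (For ''j'' (IMul vn vd) ?c2) ?st1) \<and>
    (\<forall>j<n * d. mem (exec s (For ''j'' (IMul vn vd) ?c2) ?st1) (''out'', j) = act_at (L * n * d + j))"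
  proof (rule For_rule[where I = "\<lambda>J M. \<forall>j<J. M (''out'', j) = act_at (L * n * d + j)"])
    fix j st2
    assume j: "j < n * d" and ev: "evolves (block ''out'' (n * d)) {''j''} (j * 0) ?st1 st2"
      and ix: "idx st2 ''j'' = j" and I: "\<forall>j'<j. mem st2 (''out'', j') = act_at (L * n * d + j')"
    have [simp]: "idx st2 ''d'' = d" "idx st2 ''L'' = L" "idx st2 ''n'' = n"
      using evolves_idx[OF ev] by (auto simp del: exec.simps)
    have "L * n * d + j < K" using j by (simp add: K_def algebra_simps)
    then have "mem st2 (''x'', L * n * d + j) = act_at (L * n * d + j)"
      using conjunct2[OF 1] evolves_mem[OF ev, of "(''x'', L * n * d + j)"]
      by (simp add: block_def del: exec.simps)
    then show "evolves (block ''out'' (n * d)) {''j''} 0 st2 (exec s ?c2 st2) \<and>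
      (\<forall>j'<Suc j. mem (exec s ?c2 st2) (''out'', j') = act_at (L * n * d + j'))"
      using I j by (auto simp: less_Suc_eq get_def cell_of_def ix mult.assoc evolves_def put_def block_def)
  qed (simp_all del: exec.simps)
  have exec: "exec s forward_prog st = exec s (For ''j'' (IMul vn vd) ?c2) ?st1"
    by (simp add: forward_prog_def)
  show ?ev unfolding exec
    by (rule evolves_mono[OF evolves_trans[OF conjunct1[OF 1] conjunct1[OF 2]]]) auto
  show ?out using 2 unfolding exec by blast
  show ?act
  proof -
    have "mem (exec s forward_prog st) (''x'', j) = mem ?st1 (''x'', j)"
      "mem (exec s forward_prog st) (''D'', j) = mem ?st1 (''D'', j)" for j
      unfolding exec by (rule evolves_mem[OF conjunct1[OF 2]], simp add: block_def)+
    then show ?thesis using conjunct2[OF 1] by (simp del: exec.simps)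
  qed
qed

text \<open>Blocks are filled in increasing \<open>b\<close>, so the recursion reads rows already
  stored. A round costs at most \<open>2 * d\<close> for the sum and one for the factor from
  \<open>D\<close>.\<close>

lemma backward_prog_correct:
  assumes d: "idx st ''d'' = d" and L: "idx st ''L'' = L" and n: "idx st ''n'' = n"
    and W: "\<And>k. k < d^2 * L \<Longrightarrow> mem st (''W'', k) = weight_vec d L W $ k"
    and D: "\<And>j. j < (L + 1) * n * d \<Longrightarrow> 1 \<le> j div d div n \<Longrightarrow> mem st (''D'', j) = slope_at j"
  defines "K \<equiv> L * n * d * d"
  shows "evolves (block ''B'' K \<union> scratch) {''j'', ''r''}
      (K * (2 * d + 1)) st (exec s backward_prog st) \<and>
    (\<forall>j<K. mem (exec s backward_prog st) (''B'', j) = backprop_at j)"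
  unfolding backward_prog_def
proof (rule For_rule[where I = "\<lambda>J M. \<forall>j<J. M (''B'', j) = backprop_at j"])
  fix j st1
  let ?F = "block ''B'' K \<union> scratch" and ?V = "{''j'', ''r''}"
  let ?b = "IDiv (IDiv (IDiv vj vd) vd) vn"
  let ?p = "(''B'', flat vd (ISub (IDiv vj vd) (IMul vn vd)) vr)"
    and ?q = "(''W'', flat vd (flat vd (ISub vL ?b) (IMod vj vd)) vr)"
  let ?unit = "If_ILe (IMod (IDiv vj vd) vd) (IMod vj vd)
             (If_ILe (IMod vj vd) (IMod (IDiv vj vd) vd) (Const acc 1) (Const acc 0))
             (Const acc 0)"
  let ?c1 = "If_ILe (IConst (Suc 0)) ?b (dot vd ?p ?q) ?unit"
  let ?c2 = "Binary Times (''B'', vj) acc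
    (''D'', flat vd (flat vn (ISub vL ?b) (IMod (IDiv (IDiv vj vd) vd) vn)) (IMod vj vd))"
  assume j: "j < K" and ev: "evolves ?F ?V (j * (2 * d + 1)) st st1" and ix: "idx st1 ''j'' = j"
    and I: "\<forall>j'<j. mem st1 (''B'', j') = backprop_at j'"
  have [simp]: "idx st1 ''d'' = d" "idx st1 ''L'' = L" "idx st1 ''n'' = n"
    using evolves_idx[OF ev] d L n by auto
  have "j div d < L * n * d" using j by (simp add: K_def less_mult_imp_div_less)
  then obtain b i a where b: "b < L" and i: "i < n" and a: "a < d"
    and jd: "j div d = (b * n + i) * d + a"
    using decode_layer by blast
  define c where "c = j mod d"
  have c: "c < d" using pos by (simp add: c_def)
  have j_eq: "j = ((b * n + i) * d + a) * d + c" using jd by (metis c_def div_mult_mod_eq)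
  have dig: "j div d div d = b * n + i" "j div d mod d = a" "j mod d = c"
    "(b * n + i) div n = b" "(b * n + i) mod n = i"
    using i a by (simp_all add: jd c_def)
  \<comment> \<open>Both branches leave in \<open>acc\<close> what \<open>slope\<close> still has to
    multiply: an entry of the unit matrix, or the sum of the recursion.\<close>
  have *: "evolves ?F ?V (2 * d) st1 (exec s ?c1 st1) \<and>
    mem (exec s ?c1 st1) (''acc'', 0) * slope (x i) (L - b) c = backprop_at j \<and>
    (\<forall>k. fst k \<notin> {''acc'', ''t''} \<longrightarrow> mem (exec s ?c1 st1) k = mem st1 k) \<and>
    idx (exec s ?c1 st1) ''j'' = j"
  proof (cases b)
    case 0
    \<comment> \<open>The nested index comparisons test \<open>a = c\<close> by two inequalities,
      without any real operation.\<close>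
    have exec: "exec s ?c1 st1 = put acc (if a = c then 1 else 0) st1"
      using dig 0 by (auto simp: ix)
    then have "mem (exec s ?c1 st1) (''acc'', 0) * slope (x i) (L - b) c = backprop_at j"
      using dig 0 by (simp add: backprop_at_def cell_of_def)
    then show ?thesis unfolding exec
      by (auto simp: cell_of_def ix intro!: evolves_put) (auto simp: evolves_def)
  next
    case (Suc b')
    have exec: "exec s ?c1 st1 = exec s (dot vd ?p ?q) st1"
      using dig Suc by (simp add: ix)
    have ev2: "evolves scratch {''r''} (2 * d) st1 (exec s (dot vd ?p ?q) st1)"
      by (rule exec_dot) simp_all
    \<comment> \<open>Going back \<open>n * d\<close> rows keeps \<open>i\<close> and
      \<open>a\<close> and lowers \<open>b\<close> by one.\<close>
    have sub: "j div d - n * d = (b' * n + i) * d + a" by (simp add: jd Suc algebra_simps)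
    have summand: "mem st1 (''B'', ((b' * n + i) * d + a) * d + r) = backprop (x i) b' a r"
      "mem st1 (''W'', ((L - b) * d + c) * d + r) = W (L - b') $$ (r, c)" if r: "r < d" for r
    proof -
      have "((b' * n + i) * d + a) * d + r < ((b' * n + i) * d + a + 1) * d" using r by simp
      also have "\<dots> \<le> ((b * n + i) * d + a) * d"
        unfolding Suc using pos by (intro mult_right_mono) (auto simp: algebra_simps)
      finally have "((b' * n + i) * d + a) * d + r < j" by (simp add: j_eq)
      then show "mem st1 (''B'', ((b' * n + i) * d + a) * d + r) = backprop (x i) b' a r"
        using I i a r by (simp add: backprop_at_def)
      \<comment> \<open>The weight array counts layers from 0 and the matrices from 1, so block
        \<open>L - b\<close> is the matrix \<open>W (L - b')\<close> of the recursion.\<close>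
      have Lb: "L - b < L" "Suc (L - b) = L - b'" using b Suc by auto
      show "mem st1 (''W'', ((L - b) * d + c) * d + r) = W (L - b') $$ (r, c)"
        using evolves_mem[OF ev, of "(''W'', ((L - b) * d + c) * d + r)"]
          W[OF weight_index_less[OF Lb(1) c r]] weight_vec_index[OF Lb(1) c r] Lb(2)
        by (simp add: block_def)
    qed
    have "mem (exec s (dot vd ?p ?q) st1) (''acc'', 0) =
        (\<Sum>r<d. mem st1 (''B'', ((b' * n + i) * d + a) * d + r) *
          mem st1 (''W'', ((L - b) * d + c) * d + r))"
      by (subst exec_dot(2)[where K = d]) (simp_all add: ix dig sub)
    also have "\<dots> = (\<Sum>r<d. backprop (x i) b' a r * W (L - b') $$ (r, c))"
      by (intro sum.cong refl) (simp add: summand)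
    finally have "mem (exec s (dot vd ?p ?q) st1) (''acc'', 0) * slope (x i) (L - b) c = backprop_at j"
      using dig Suc by (simp add: backprop_at_def)
    moreover have "mem (exec s (dot vd ?p ?q) st1) k = mem st1 k"
      if "fst k \<notin> {''acc'', ''t''}" for k
      by (rule evolves_mem[OF ev2]) (use that in auto)
    ultimately show ?thesis unfolding exec
      using evolves_mono[OF ev2, of ?F ?V] evolves_idx[OF ev2, of "''j''"] ix by auto
  qed
  let ?st2 = "exec s ?c1 st1"
  have ev2: "evolves ?F ?V (2 * d) st1 ?st2"
    and accv: "mem ?st2 (''acc'', 0) * slope (x i) (L - b) c = backprop_at j"
    and other: "\<And>k. fst k \<notin> {''acc'', ''t''} \<Longrightarrow> mem ?st2 k = mem st1 k"
    and ix2: "idx ?st2 ''j'' = j" using * by blast+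
  have [simp]: "idx ?st2 ''d'' = d" "idx ?st2 ''L'' = L" "idx ?st2 ''n'' = n"
    using evolves_idx[OF ev2] by (auto simp del: exec.simps)
  have Lb: "L - b < L + 1" by simp
  \<comment> \<open>\<open>b < L\<close> makes \<open>L - b\<close> at least 1, a layer for which
    \<open>D\<close> is set.\<close>
  have "mem ?st2 (''D'', ((L - b) * n + i) * d + c) = slope (x i) (L - b) c"
    using other[of "(''D'', ((L - b) * n + i) * d + c)"]
      evolves_mem[OF ev, of "(''D'', ((L - b) * n + i) * d + c)"]
      D[OF mult_add_less[OF mult_add_less[OF Lb i] c]] b i c
    by (simp add: block_def slope_at_def del: exec.simps)
  then have "mem (exec s (Seq ?c1 ?c2) st1) = (mem ?st2)((''B'', j) := backprop_at j)"
    using accv i unfolding exec.simps(2) exec.simps(7)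
    by (simp add: get_def cell_of_def ix2 dig del: exec.simps)
  then have "\<forall>j'<Suc j. mem (exec s (Seq ?c1 ?c2) st1) (''B'', j') = backprop_at j'"
    using I other by (simp add: less_Suc_eq del: exec.simps)
  moreover have "evolves ?F ?V (Suc (2 * d)) st1 (exec s (Seq ?c1 ?c2) st1)"
    unfolding exec.simps(2) exec.simps(7)
    by (intro evolves_tick evolves_put ev2) (use j in \<open>simp add: cell_of_def ix2 block_def del: exec.simps\<close>)
  ultimately show "evolves ?F ?V (2 * d + 1) st1 (exec s (Seq ?c1 ?c2) st1) \<and>
      (\<forall>j'<Suc j. mem (exec s (Seq ?c1 ?c2) st1) (''B'', j') = backprop_at j')"
    by (simp del: exec.simps)
qed (simp_all add: d L n K_def)

text \<open>Column-major storage of \<open>Q\<close> puts entry \<open>(a, r)\<close> at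
  \<open>(i * d + r) * d + a\<close>, so the sum over \<open>r\<close> strides through a row of
  \<open>Q\<close> and a column of \<open>B\<close>.\<close>

lemma loss_prog_correct:
  assumes d: "idx st ''d'' = d" and L: "idx st ''L'' = L" and n: "idx st ''n'' = n"
    and Q: "\<And>i r a. i < n \<Longrightarrow> r < d \<Longrightarrow> a < d \<Longrightarrow> mem st (''Q'', (i * d + r) * d + a) = Q i $$ (a, r)"
    and B: "\<forall>j<L * n * d * d. mem st (''B'', j) = backprop_at j"
  defines "K \<equiv> L * n * d * d"
  shows "evolves (block ''G'' K \<union> scratch) {''j'', ''r''}
      (K * (2 * d)) st (exec s loss_prog st) \<and>
    (\<forall>j<K. mem (exec s loss_prog st) (''G'', j) = loss_at Q j)"
  unfolding loss_prog_def
proof (rule For_rule[where I = "\<lambda>J M. \<forall>j<J. M (''G'', j) = loss_at Q j"])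
  fix j st1
  let ?F = "block ''G'' K \<union> scratch" and ?V = "{''j'', ''r''}"
  let ?p = "(''Q'', flat vd (flat vd (IMod (IDiv (IDiv vj vd) vd) vn) vr) (IMod (IDiv vj vd) vd))"
    and ?q = "(''B'', flat vd (flat vd (IDiv (IDiv vj vd) vd) vr) (IMod vj vd))"
  let ?c = "Seq (dot vd ?p ?q) (Copy (''G'', vj) acc)"
  assume j: "j < K" and ev: "evolves ?F ?V (j * (2 * d)) st st1" and ix: "idx st1 ''j'' = j"
    and I: "\<forall>j'<j. mem st1 (''G'', j') = loss_at Q j'"
  have [simp]: "idx st1 ''d'' = d" "idx st1 ''L'' = L" "idx st1 ''n'' = n"
    using evolves_idx[OF ev] d L n by auto
  have "j div d < L * n * d" using j by (simp add: K_def less_mult_imp_div_less)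
  then obtain b i a where b: "b < L" and i: "i < n" and a: "a < d"
    and jd: "j div d = (b * n + i) * d + a"
    using decode_layer by blast
  define c where "c = j mod d"
  have c: "c < d" using pos by (simp add: c_def)
  have dig: "j div d div d = b * n + i" "j div d mod d = a" "j mod d = c"
    "(b * n + i) div n = b" "(b * n + i) mod n = i"
    using i a by (simp_all add: jd c_def)
  let ?st2 = "exec s (dot vd ?p ?q) st1"
  have ev2: "evolves scratch {''r''} (2 * d) st1 ?st2"
    by (rule exec_dot) simp_all
  have ix2: "idx ?st2 ''j'' = j" using evolves_idx[OF ev2] ix by simp
  have summand: "mem st1 (''Q'', (i * d + r) * d + a) = Q i $$ (a, r)"
    "mem st1 (''B'', ((b * n + i) * d + r) * d + c) = backprop (x i) b r c" if r: "r < d" for r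
    using evolves_mem[OF ev, of "(''Q'', (i * d + r) * d + a)"] Q[OF i r a]
      evolves_mem[OF ev, of "(''B'', ((b * n + i) * d + r) * d + c)"]
      mult_add_less[OF mult_add_less[OF mult_add_less[OF b i] r] c] B i r c
    by (simp_all add: block_def backprop_at_def)
  have "mem ?st2 (''acc'', 0) = (\<Sum>r<d. mem st1 (''Q'', (i * d + r) * d + a) *
      mem st1 (''B'', ((b * n + i) * d + r) * d + c))"
    by (subst exec_dot(2)[where K = d]) (use i in \<open>simp_all add: ix dig\<close>)
  also have "\<dots> = (\<Sum>r<d. Q i $$ (a, r) * backprop (x i) b r c)"
    by (intro sum.cong refl) (simp add: summand)
  finally have "mem ?st2 (''acc'', 0) = loss_at Q j" using i by (simp add: loss_at_def dig)
  moreover have "mem ?st2 (''G'', j') = mem st1 (''G'', j')" for j'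
    by (rule evolves_mem[OF ev2]) simp
  ultimately have "\<forall>j'<Suc j. mem (exec s ?c st1) (''G'', j') = loss_at Q j'"
    using I by (simp add: less_Suc_eq get_def cell_of_def ix2)
  moreover have "evolves ?F ?V (2 * d) st1 (exec s ?c st1)"
    unfolding exec.simps
    by (intro evolves_put evolves_mono[OF ev2]) (use j in \<open>auto simp: cell_of_def ix2 block_def\<close>)
  ultimately show "evolves ?F ?V (2 * d) st1 (exec s ?c st1) \<and>
      (\<forall>j'<Suc j. mem (exec s ?c st1) (''G'', j') = loss_at Q j')"
    by blast
qed (simp_all add: d L n K_def)

text \<open>Expressed by raw cells of an arbitrary memory, since a query starts from whatever
  earlier queries left. Each data point costs \<open>2 * d\<close> for the inner product, two for
  the scalings and one for the addition to the result.\<close>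

lemma entry_prog_exec:
  assumes d: "idx st ''d'' = d" and L: "idx st ''L'' = L" and n: "idx st ''n'' = n"
    and k: "idx st ''k'' = k" and m: "idx st ''m'' = m"
  shows "evolves (scratch \<union> {(''H'', 0)}) {''j'', ''r''} (n * (2 * d + 3)) st (exec s entry_prog st) \<and>
    mem (exec s entry_prog st) (''H'', 0) = (\<Sum>i<n.
      (\<Sum>a<d. mem st (''B'', (((L - Suc (k div d div d)) * n + i) * d + a) * d + k mod d) *
        mem st (''G'', (((L - Suc (m div d div d)) * n + i) * d + a) * d + m mod d)) *
      mem st (''x'', (k div d div d * n + i) * d + k div d mod d) *
      mem st (''x'', (m div d div d * n + i) * d + m div d mod d))"
proof -
  let ?F = "scratch \<union> {(''H'', 0)}" and ?V = "{''j'', ''r''}"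
  let ?dot = "\<lambda>i. \<Sum>a<d. mem st (''B'', (((L - Suc (k div d div d)) * n + i) * d + a) * d + k mod d) *
        mem st (''G'', (((L - Suc (m div d div d)) * n + i) * d + a) * d + m mod d)"
  let ?xk = "\<lambda>i. mem st (''x'', (k div d div d * n + i) * d + k div d mod d)"
  let ?xm = "\<lambda>i. mem st (''x'', (m div d div d * n + i) * d + m div d mod d)"
  let ?st = "put (''H'', IConst 0) 0 st"
  let ?rest = "Seq (Binary Times acc acc (''x'', input_entry ''k''))
       (Seq (Binary Times acc acc (''x'', input_entry ''m''))
            (Binary Plus (''H'', IConst 0) (''H'', IConst 0) acc))"
  let ?dotc = "dot vd (''B'', column ''k'') (''G'', column ''m'')"
  have start: "evolves ?F ?V 0 st ?st"
    by (intro evolves_put) (auto simp: evolves_def cell_of_def)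
  have loop: "evolves ?F ?V (n * (2 * d + 3)) ?st (exec s (For ''j'' vn (Seq ?dotc ?rest)) ?st) \<and>
    mem (exec s (For ''j'' vn (Seq ?dotc ?rest)) ?st) (''H'', 0) =
      (\<Sum>i<n. ?dot i * ?xk i * ?xm i)"
  proof (rule For_rule[where I = "\<lambda>J M. M (''H'', 0) = (\<Sum>i<J. ?dot i * ?xk i * ?xm i)"])
    fix i st1
    assume ev: "evolves ?F ?V (i * (2 * d + 3)) ?st st1" and ix: "idx st1 ''j'' = i"
      and I: "mem st1 (''H'', 0) = (\<Sum>i<i. ?dot i * ?xk i * ?xm i)"
    have ixs: "idx st1 ''d'' = d" "idx st1 ''L'' = L" "idx st1 ''n'' = n"
      "idx st1 ''k'' = k" "idx st1 ''m'' = m"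
      using evolves_idx[OF ev] assms by auto
    have same: "mem st1 (''B'', j) = mem st (''B'', j)" "mem st1 (''G'', j) = mem st (''G'', j)"
      "mem st1 (''x'', j) = mem st (''x'', j)" for j
      using evolves_mem[OF evolves_trans[OF start ev]] by simp_all
    let ?st2 = "exec s ?dotc st1"
    have ev2: "evolves scratch {''r''} (2 * d) st1 ?st2"
      by (rule exec_dot) (simp_all add: ixs)
    have ixs2: "idx ?st2 ''j'' = i" "idx ?st2 ''d'' = d" "idx ?st2 ''L'' = L" "idx ?st2 ''n'' = n"
      "idx ?st2 ''k'' = k" "idx ?st2 ''m'' = m"
      using evolves_idx[OF ev2] ixs ix by simp_all
    have accv: "mem ?st2 (''acc'', 0) = ?dot i"
      by (subst exec_dot(2)[where K = d]) (simp_all add: ix ixs same column_def)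
    have same2: "mem ?st2 (''x'', j) = mem st (''x'', j)" "mem ?st2 (''H'', 0) = mem st1 (''H'', 0)"
      for j
      using evolves_mem[OF ev2] same by simp_all
    have "evolves ?F ?V (Suc (Suc (Suc (2 * d)))) st1 (exec s (Seq ?dotc ?rest) st1)"
      unfolding exec.simps
      by (intro evolves_tick evolves_put evolves_mono[OF ev2]) (auto simp: cell_of_def)
    moreover have "mem (exec s (Seq ?dotc ?rest) st1) (''H'', 0) =
        (\<Sum>i<Suc i. ?dot i * ?xk i * ?xm i)"
      using I by (simp add: get_def cell_of_def input_entry_def ixs2 same2 accv)
    ultimately show "evolves ?F ?V (2 * d + 3) st1 (exec s (Seq ?dotc ?rest) st1) \<and>
        mem (exec s (Seq ?dotc ?rest) st1) (''H'', 0) = (\<Sum>i<Suc i. ?dot i * ?xk i * ?xm i)"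
      by (simp add: numeral_3_eq_3)
  qed (simp_all add: n cell_of_def)
  have "exec s entry_prog st = exec s (For ''j'' vn (Seq ?dotc ?rest)) ?st"
    by (simp add: entry_prog_def)
  then show ?thesis
    using loop evolves_trans[OF start conjunct1[OF loop]] by simp
qed

section \<open>Hessian entries in terms of backpropagated columns\<close>

lemma gauss_newton_entry:
  assumes Q: "\<And>i. i < n \<Longrightarrow> loss_hessian s L n W x f y i \<in> carrier_mat d d"
    and k: "l < L" "c < d" "r < d" and m: "l' < L" "c' < d" "r' < d"
  shows "gauss_newton_hessian s d L n W x f y $$ ((l * d + c) * d + r, (l' * d + c') * d + r') =
    (\<Sum>i<n. (\<Sum>a<d. backprop (x i) (L - Suc l) a r *
        (\<Sum>e<d. loss_hessian s L n W x f y i $$ (a, e) * backprop (x i) (L - Suc l') e r')) *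
      forward s W (x i) l $ c * forward s W (x i) l' $ c')"
proof -
  let ?k = "(l * d + c) * d + r" and ?m = "(l' * d + c') * d + r'"
  have N: "?k < d\<^sup>2 * L" "?m < d\<^sup>2 * L" using weight_index_less k m by auto
  have "(transpose_mat (output_jacobian s d L W (x i)) * loss_hessian s L n W x f y i *
      output_jacobian s d L W (x i)) $$ (?k, ?m) =
    (\<Sum>a<d. backprop (x i) (L - Suc l) a r *
        (\<Sum>e<d. loss_hessian s L n W x f y i $$ (a, e) * backprop (x i) (L - Suc l') e r')) *
      forward s W (x i) l $ c * forward s W (x i) l' $ c'" if i: "i < n" for i
  proof -
    let ?J = "output_jacobian s d L W (x i)" and ?Q = "loss_hessian s L n W x f y i"
    have J: "?J \<in> carrier_mat d (d\<^sup>2 * L)" by (simp add: output_jacobian_def)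
    note QC = Q[OF i]
    have "(transpose_mat ?J * ?Q * ?J) $$ (?k, ?m) =
        (\<Sum>a<d. \<Sum>e<d. ?J $$ (a, ?k) * (?Q $$ (a, e) * ?J $$ (e, ?m)))"
      using J QC N by (simp add: scalar_prod_def atLeast0LessThan sum_distrib_left)
    also have "\<dots> = (\<Sum>a<d. \<Sum>e<d. (backprop (x i) (L - Suc l) a r * forward s W (x i) l $ c) *
        (?Q $$ (a, e) * (backprop (x i) (L - Suc l') e r' * forward s W (x i) l' $ c')))"
      by (intro sum.cong refl)
        (simp add: output_jacobian_index[OF x_dim[OF i] k] output_jacobian_index[OF x_dim[OF i] m])
    \<comment> \<open>The two input entries depend on neither summation index, so they leave the
      quadratic form.\<close>
    also have "\<dots> = (\<Sum>a<d. backprop (x i) (L - Suc l) a r *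
        (\<Sum>e<d. ?Q $$ (a, e) * backprop (x i) (L - Suc l') e r')) *
      forward s W (x i) l $ c * forward s W (x i) l' $ c'"
      by (simp add: sum_distrib_left sum_distrib_right mult_ac)
    finally show ?thesis .
  qed
  then show ?thesis using N by (simp add: gauss_newton_hessian_def)
qed

section \<open>The two stages and the queries on loaded memory\<close>

lemma stage1_correct:
  defines "st1 \<equiv> stage1 s forward_prog d L n W x" and "K \<equiv> (L + 1) * n * d"
  shows "work st1 \<le> K * (2 * d + 2)"
    and "used st1 \<subseteq> block ''W'' (d\<^sup>2 * L) \<union> block ''X'' (n * d) \<union>
      (block ''x'' K \<union> block ''D'' K \<union> block ''out'' (n * d) \<union> scratch)"
    and "k < d\<^sup>2 * L \<Longrightarrow> mem st1 (''W'', k) = weight_vec d L W $ k"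
    and "j < K \<Longrightarrow> mem st1 (''x'', j) = act_at j"
    and "j < K \<Longrightarrow> 1 \<le> j div d div n \<Longrightarrow> mem st1 (''D'', j) = slope_at j"
    and "i < n \<Longrightarrow> r < d \<Longrightarrow> mem st1 (''out'', i * d + r) = forward s W (x i) L $ r"
proof -
  define st0 where "st0 = \<lparr>idx = sizes d L n,
    mem = load ''W'' (d^2 * L) (\<lambda>k. weight_vec d L W $ k)
         (load ''X'' (n * d) (\<lambda>j. x (j div d) $ (j mod d)) (\<lambda>_. 0)),
    work = 0, used = block ''W'' (d^2 * L) \<union> block ''X'' (n * d)\<rparr>"
  have st1: "st1 = exec s forward_prog st0"
    by (simp add: st1_def stage1_def run_def st0_def)
  have init: "idx st0 ''d'' = d" "idx st0 ''L'' = L" "idx st0 ''n'' = n"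
    "\<And>k. k < d^2 * L \<Longrightarrow> mem st0 (''W'', k) = weight_vec d L W $ k"
    "\<And>j. j < n * d \<Longrightarrow> mem st0 (''X'', j) = x (j div d) $ (j mod d)"
    by (simp_all add: st0_def sizes_def load_def)
  note correct = forward_prog_correct[OF init, folded st1 K_def]
  show "work st1 \<le> K * (2 * d + 2)"
    using evolves_work[OF correct(1)] by (simp add: st0_def)
  show "used st1 \<subseteq> block ''W'' (d\<^sup>2 * L) \<union> block ''X'' (n * d) \<union>
      (block ''x'' K \<union> block ''D'' K \<union> block ''out'' (n * d) \<union> scratch)"
    using evolves_used[OF correct(1)] by (simp add: st0_def)
  show "k < d\<^sup>2 * L \<Longrightarrow> mem st1 (''W'', k) = weight_vec d L W $ k"
    using evolves_mem[OF correct(1), of "(''W'', k)"] init(4) by (simp add: block_def)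
  show "j < K \<Longrightarrow> mem st1 (''x'', j) = act_at j"
    and "j < K \<Longrightarrow> 1 \<le> j div d div n \<Longrightarrow> mem st1 (''D'', j) = slope_at j"
    using correct(2) by blast+
  assume i: "i < n" and r: "r < d"
  have "L * n * d + (i * d + r) = (L * n + i) * d + r" by (simp add: algebra_simps)
  then show "mem st1 (''out'', i * d + r) = forward s W (x i) L $ r"
    using correct(3) mult_add_less[OF i r] i r by (simp add: act_at_def)
qed

lemma stage2_correct:
  assumes Q: "\<And>i. i < n \<Longrightarrow> Q i \<in> carrier_mat d d"
  defines "st1 \<equiv> stage1 s forward_prog d L n W x"
  defines "st2 \<equiv> stage2 s (Seq backward_prog loss_prog) d L n Q st1" and "K \<equiv> L * n * d * d"
  shows "work st2 \<le> K * (4 * d + 1)"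
    and "used st2 \<subseteq> used st1 \<union> block ''Q'' (n * d\<^sup>2) \<union> block ''B'' K \<union> block ''G'' K \<union> scratch"
    and "j < (L + 1) * n * d \<Longrightarrow> mem st2 (''x'', j) = act_at j"
    and "j < K \<Longrightarrow> mem st2 (''B'', j) = backprop_at j"
    and "j < K \<Longrightarrow> mem st2 (''G'', j) = loss_at Q j"
proof -
  define st0 where "st0 = \<lparr>idx = sizes d L n,
    mem = load ''Q'' (n * d^2) (\<lambda>j. Q (j div d^2) $$ (j mod d, j mod d^2 div d)) (mem st1),
    work = 0, used = used st1 \<union> block ''Q'' (n * d^2)\<rparr>"
  let ?mid = "exec s backward_prog st0"
  have st2: "st2 = exec s loss_prog ?mid"
    by (simp add: st2_def stage2_def run_def st0_def)
  have init: "idx st0 ''d'' = d" "idx st0 ''L'' = L" "idx st0 ''n'' = n"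
    "\<And>k. k < d^2 * L \<Longrightarrow> mem st0 (''W'', k) = weight_vec d L W $ k"
    "\<And>j. j < (L + 1) * n * d \<Longrightarrow> 1 \<le> j div d div n \<Longrightarrow> mem st0 (''D'', j) = slope_at j"
    using stage1_correct(3,5) by (simp_all add: st0_def sizes_def load_def st1_def)
  have Q0: "mem st0 (''Q'', (i * d + r) * d + a) = Q i $$ (a, r)"
    if "i < n" "r < d" "a < d" for i r a
  proof -
    have "(i * d + r) * d + a < n * d\<^sup>2"
      using mult_add_less[OF mult_add_less[OF that(1,2)] that(3)]
      by (simp add: power2_eq_square mult.assoc)
    \<comment> \<open>The input is addressed with blocks of length \<open>d^2\<close>; splitting the
      offset in a block into two digits of base \<open>d\<close> gives the Horner form.\<close>
    then show ?thesis
      using that by (simp add: st0_def load_def power2_eq_square div_mult2_eq mod_mult2_eq)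
  qed
  note bwd = backward_prog_correct[OF init, folded K_def]
  have init': "idx ?mid ''d'' = d" "idx ?mid ''L'' = L" "idx ?mid ''n'' = n"
    "\<And>i r a. i < n \<Longrightarrow> r < d \<Longrightarrow> a < d \<Longrightarrow> mem ?mid (''Q'', (i * d + r) * d + a) = Q i $$ (a, r)"
    using evolves_idx[OF conjunct1[OF bwd]] init Q0
      evolves_mem[OF conjunct1[OF bwd], of "(''Q'', _)"] by (simp_all add: block_def)
  note loss = loss_prog_correct[OF init' conjunct2[OF bwd[unfolded K_def]], folded K_def st2]
  note ev = evolves_trans[OF conjunct1[OF bwd] conjunct1[OF loss]]
  have "K * (2 * d + 1) + K * (2 * d) = K * (4 * d + 1)" by (simp add: algebra_simps)
  then show "work st2 \<le> K * (4 * d + 1)"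
    using evolves_work[OF ev] by (simp add: st0_def)
  show "used st2 \<subseteq> used st1 \<union> block ''Q'' (n * d\<^sup>2) \<union> block ''B'' K \<union> block ''G'' K \<union> scratch"
    using evolves_used[OF ev] by (auto simp: st0_def)
  show "mem st2 (''x'', j) = act_at j" if "j < (L + 1) * n * d"
    using evolves_mem[OF ev, of "(''x'', j)"] stage1_correct(4)[OF that]
    by (simp add: block_def st0_def load_def st1_def)
  show "mem st2 (''B'', j) = backprop_at j" if "j < K"
    using evolves_mem[OF conjunct1[OF loss], of "(''B'', j)"] conjunct2[OF bwd] that
    by (simp add: block_def)
  show "mem st2 (''G'', j) = loss_at Q j" if "j < K"
    using conjunct2[OF loss] that by blast
qed

lemma entry_query_exec:
  defines "q \<equiv> \<lambda>km M. entry_query s entry_prog d L n km M"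
  shows "work (q (k, m) M) \<le> n * (2 * d + 3)"
    and "p \<notin> scratch \<union> {(''H'', 0)} \<Longrightarrow> mem (q km M) p = M p"
    and "mem (q (k, m) M) (''H'', 0) = (\<Sum>i<n.
      (\<Sum>a<d. M (''B'', (((L - Suc (k div d div d)) * n + i) * d + a) * d + k mod d) *
        M (''G'', (((L - Suc (m div d div d)) * n + i) * d + a) * d + m mod d)) *
      M (''x'', (k div d div d * n + i) * d + k div d mod d) *
      M (''x'', (m div d div d * n + i) * d + m div d mod d))"
proof -
  define st where "st km = \<lparr>idx = (sizes d L n)(''k'' := fst km, ''m'' := snd km), mem = M,
    work = 0, used = {}\<rparr>" for km
  have q: "q km M = exec s entry_prog (st km)" for km
    by (simp add: q_def entry_query_def run_def st_def)
  have init: "idx (st km) ''d'' = d" "idx (st km) ''L'' = L" "idx (st km) ''n'' = n"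
    "idx (st km) ''k'' = fst km" "idx (st km) ''m'' = snd km" for km
    by (simp_all add: st_def sizes_def)
  note e = entry_prog_exec[OF init, folded q]
  show "work (q (k, m) M) \<le> n * (2 * d + 3)"
    using evolves_work[OF conjunct1[OF e]] by (simp add: st_def)
  show "p \<notin> scratch \<union> {(''H'', 0)} \<Longrightarrow> mem (q km M) p = M p"
    using evolves_mem[OF conjunct1[OF e], of p km] by (simp add: st_def)
  show "mem (q (k, m) M) (''H'', 0) = (\<Sum>i<n.
      (\<Sum>a<d. M (''B'', (((L - Suc (k div d div d)) * n + i) * d + a) * d + k mod d) *
        M (''G'', (((L - Suc (m div d div d)) * n + i) * d + a) * d + m mod d)) *
      M (''x'', (k div d div d * n + i) * d + k div d mod d) *
      M (''x'', (m div d div d * n + i) * d + m div d mod d))"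
    using conjunct2[OF e, of "(k, m)"] by (simp add: st_def)
qed

text \<open>Each query writes only the two scratch cells and the result cell, so the tables survive
  any number of queries.\<close>

lemma mem_after_queries:
  "p \<notin> scratch \<union> {(''H'', 0)} \<Longrightarrow> mem_after = after_queries s entry_prog d L n kms M \<Longrightarrow>
    mem_after p = M p"
proof (induction kms arbitrary: M)
  case (Cons km kms)
  then show ?case using entry_query_exec(2)[of p km M] by (simp add: after_queries_def)
qed (simp add: after_queries_def)

lemma decode_weight:
  assumes "k < d\<^sup>2 * L"
  obtains l c r where "l < L" "c < d" "r < d" "k = (l * d + c) * d + r"
proof (rule that)
  show "k div d div d < L"
    using assms by (intro less_mult_imp_div_less) (simp add: power2_eq_square mult_ac)
  show "k = (k div d div d * d + k div d mod d) * d + k mod d" by simp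
qed (use pos in simp_all)

text \<open>Only the tables \<open>x\<close>, \<open>B\<close> and \<open>G\<close> are required of
  \<open>M\<close>, and earlier queries preserve them. \<open>G\<close> already contains the product
  with the loss Hessian, which leaves one inner product per data point.\<close>

lemma entry_query_correct:
  assumes Q: "\<And>i. i < n \<Longrightarrow> loss_hessian s L n W x f y i \<in> carrier_mat d d"
    and k: "k < d\<^sup>2 * L" and m: "m < d\<^sup>2 * L"
    and M_x: "\<And>j. j < (L + 1) * n * d \<Longrightarrow> M (''x'', j) = act_at j"
    and M_B: "\<And>j. j < L * n * d * d \<Longrightarrow> M (''B'', j) = backprop_at j"
    and M_G: "\<And>j. j < L * n * d * d \<Longrightarrow> M (''G'', j) = loss_at (loss_hessian s L n W x f y) j"
  shows "mem (entry_query s entry_prog d L n (k, m) M) (''H'', 0) =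
    gauss_newton_hessian s d L n W x f y $$ (k, m)"
proof -
  obtain l c r where l: "l < L" "c < d" "r < d" and k_eq: "k = (l * d + c) * d + r"
    using decode_weight[OF k] .
  obtain l' c' r' where l': "l' < L" "c' < d" "r' < d" and m_eq: "m = (l' * d + c') * d + r'"
    using decode_weight[OF m] .
  have dig: "k div d = l * d + c" "k mod d = r" "(l * d + c) div d = l" "(l * d + c) mod d = c"
    "m div d = l' * d + c'" "m mod d = r'" "(l' * d + c') div d = l'" "(l' * d + c') mod d = c'"
    using l l' by (simp_all add: k_eq m_eq)
  have x: "M (''x'', (l * n + i) * d + c) = forward s W (x i) l $ c"
    if "l < L" "i < n" "c < d" for l i c
    using M_x[OF mult_add_less[OF mult_add_less[of l "L + 1" i n] that(3)]] that
    by (simp add: act_at_def)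
  have B: "M (''B'', (((L - Suc l) * n + i) * d + a) * d + r) = backprop (x i) (L - Suc l) a r"
    and G: "M (''G'', (((L - Suc l) * n + i) * d + a) * d + r) =
      (\<Sum>e<d. loss_hessian s L n W x f y i $$ (a, e) * backprop (x i) (L - Suc l) e r)"
    if "l < L" "i < n" "a < d" "r < d" for l i a r
  proof -
    have "(((L - Suc l) * n + i) * d + a) * d + r < L * n * d * d"
      using that by (intro mult_add_less) auto
    then show "M (''B'', (((L - Suc l) * n + i) * d + a) * d + r) = backprop (x i) (L - Suc l) a r"
      and "M (''G'', (((L - Suc l) * n + i) * d + a) * d + r) =
        (\<Sum>e<d. loss_hessian s L n W x f y i $$ (a, e) * backprop (x i) (L - Suc l) e r)"
      using that by (simp_all add: M_B M_G backprop_at_def loss_at_def)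
  qed
  have "mem (entry_query s entry_prog d L n (k, m) M) (''H'', 0) = (\<Sum>i<n.
      (\<Sum>a<d. M (''B'', (((L - Suc l) * n + i) * d + a) * d + r) *
        M (''G'', (((L - Suc l') * n + i) * d + a) * d + r')) *
      M (''x'', (l * n + i) * d + c) * M (''x'', (l' * n + i) * d + c'))"
    by (simp only: entry_query_exec(3) dig)
  also have "\<dots> = (\<Sum>i<n. (\<Sum>a<d. backprop (x i) (L - Suc l) a r *
        (\<Sum>e<d. loss_hessian s L n W x f y i $$ (a, e) * backprop (x i) (L - Suc l') e r')) *
      forward s W (x i) l $ c * forward s W (x i) l' $ c')"
    using l l' by (intro sum.cong arg_cong2[where f = "(*)"] refl) (simp_all add: x B G)
  also have "\<dots> = gauss_newton_hessian s d L n W x f y $$ (k, m)"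
    using gauss_newton_entry[OF Q l l'] by (simp add: k_eq m_eq)
  finally show ?thesis .
qed

section \<open>Storage and work bounds\<close>

lemma stored_cells:
  assumes Q: "\<And>i. i < n \<Longrightarrow> Q i \<in> carrier_mat d d"
  defines "st \<equiv> stage2 s (Seq backward_prog loss_prog) d L n Q (stage1 s forward_prog d L n W x)"
  shows "finite (used st) \<and> card (used st) \<le> 13 * (n * (d\<^sup>2 * L))"
proof -
  let ?N = "n * (d\<^sup>2 * L)" and ?K = "(L + 1) * n * d"
  have card: "finite (block a k) \<and> card (block a k) = k" for a k
    by (simp add: block_def card_cartesian_product)
  have un: "finite (A \<union> B) \<and> card (A \<union> B) \<le> a + b"
    if "finite A \<and> card A \<le> a" "finite B \<and> card B \<le> b" for A B :: "cell set" and a b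
    using that card_Un_le[of A B] by auto
  have le: "d\<^sup>2 * L \<le> ?N" "n * d \<le> ?N" "?K \<le> 2 * ?N" "Suc (Suc 0) \<le> 2 * ?N" "n * d\<^sup>2 \<le> ?N"
    "L * n * d * d \<le> ?N"
  proof -
    have 1: "1 \<le> d" "1 \<le> L" "1 \<le> n" using pos by auto
    show "d\<^sup>2 * L \<le> ?N" using 1 by simp
    show "n * d\<^sup>2 \<le> ?N" using 1 by simp
    show nd: "n * d \<le> ?N" using mult_le_mono[OF 1(1,2)] 1 by (simp add: power2_eq_square)
    show "L * n * d * d \<le> ?N" by (simp add: power2_eq_square mult_ac)
    \<comment> \<open>\<open>L + 1 \<le> 2 * L\<close> absorbs the extra layer 0.\<close>
    have "?K \<le> (2 * L) * n * d" using 1 by (intro mult_le_mono) auto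
    also have "\<dots> \<le> (2 * L) * n * (d * d)" using 1 by (intro mult_le_mono) auto
    finally show "?K \<le> 2 * ?N" by (simp add: power2_eq_square mult_ac)
    have "0 < ?N" using pos by simp
    then show "Suc (Suc 0) \<le> 2 * ?N" by linarith
  qed
  let ?U = "block ''W'' (d\<^sup>2 * L) \<union> block ''X'' (n * d) \<union>
      (block ''x'' ?K \<union> block ''D'' ?K \<union> block ''out'' (n * d) \<union> scratch)
      \<union> block ''Q'' (n * d\<^sup>2) \<union> block ''B'' (L * n * d * d) \<union> block ''G'' (L * n * d * d)"
  \<comment> \<open>The coefficients add up to 12, within the constant 13 shared with the work
    bound.\<close>
  have "finite ?U \<and> card ?U \<le> ?N + ?N + (2 * ?N + 2 * ?N + ?N + 2 * ?N) + ?N + ?N + ?N"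
    by (intro un) (use card le in \<open>simp_all\<close>)
  moreover have "used st \<subseteq> ?U"
    using stage1_correct(2) stage2_correct(2)[where Q = Q, OF Q] unfolding st_def by blast
  ultimately show ?thesis using card_mono[of ?U "used st"] finite_subset[of "used st" ?U] by linarith
qed

lemma precomputation_work:
  assumes Q: "\<And>i. i < n \<Longrightarrow> Q i \<in> carrier_mat d d"
  defines "st1 \<equiv> stage1 s forward_prog d L n W x"
  shows "work st1 + work (stage2 s (Seq backward_prog loss_prog) d L n Q st1) \<le>
    13 * (d * n * (d\<^sup>2 * L))"
proof -
  let ?N = "d * n * (d\<^sup>2 * L)"
  \<comment> \<open>Doubling both \<open>L\<close> and \<open>2 * d\<close> gives the factor 8; the
    forward pass in fact stays below this bound by a further factor \<open>d\<close>.\<close>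
  have "2 * d + 2 \<le> 4 * d" using pos by linarith
  then have "(L + 1) * n * d * (2 * d + 2) \<le> (2 * L) * n * d * (4 * d)"
    using pos by (intro mult_le_mono) auto
  also have "\<dots> \<le> 8 * ?N" using pos by (simp add: power2_eq_square)
  finally have work1: "work st1 \<le> 8 * ?N"
    using stage1_correct(1) unfolding st1_def by linarith
  \<comment> \<open>The backward and loss passes contribute \<open>4 * d + 1 \<le> 5 * d\<close> per
    entry. With the 8 of the forward pass this makes 13.\<close>
  have "L * n * d * d * (4 * d + 1) \<le> L * n * d * d * (5 * d)"
    using pos by (intro mult_le_mono) auto
  also have "\<dots> \<le> 5 * ?N" by (simp add: power2_eq_square)
  finally have "work (stage2 s (Seq backward_prog loss_prog) d L n Q st1) \<le> 5 * ?N"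
    using stage2_correct(1)[where Q = Q, OF Q] unfolding st1_def by linarith
  then show ?thesis using work1 by linarith
qed

end

text \<open>The constant and the programs are chosen before the sizes, hence uniform in them.
  Correctness of \<open>out\<close> belongs to the claim because the loss Hessians, supplied between
  the stages, are evaluated at these outputs; \<open>kms\<close> lets a query follow arbitrary
  earlier ones.\<close>

theorem theorem3p1:
  shows "\<exists>(C :: nat) (fwd :: com) (pre :: com) (entry :: com).
    \<forall>(d :: nat) (L :: nat) (n :: nat) (s :: real \<Rightarrow> real) (W :: nat \<Rightarrow> real mat)
      (x :: nat \<Rightarrow> real vec) (y :: nat \<Rightarrow> 'y) (f :: real vec \<Rightarrow> 'y \<Rightarrow> real).
      d \<ge> 1 \<longrightarrow> L \<ge> 1 \<longrightarrow> n \<ge> 1 \<longrightarrow>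
      (\<forall>u. s differentiable (at u)) \<longrightarrow>
      (\<forall>l \<in> {1..L}. W l \<in> carrier_mat d d) \<longrightarrow>
      (\<forall>i < n. x i \<in> carrier_vec d) \<longrightarrow>
      (\<forall>i < n. has_hessian_at (\<lambda>z. f z (y i)) (forward s W (x i) L)) \<longrightarrow>
      (\<forall>i < n. sym_pos_semidef d (loss_hessian s L n W x f y i)) \<longrightarrow>
      (let N = d^2 * L;
           st1 = stage1 s fwd d L n W x;
           st2 = stage2 s pre d L n (loss_hessian s L n W x f y) st1
       in
         (\<forall>i < n. \<forall>r < d. mem st1 (''out'', i * d + r) = forward s W (x i) L $ r) \<and>
         finite (used st2) \<and> card (used st2) \<le> C * (n * N) \<and>
         work st1 + work st2 \<le> C * (d * n * N) \<and>
         (\<forall>kms. set kms \<subseteq> {..<N} \<times> {..<N} \<longrightarrow>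
           (\<forall>k < N. \<forall>m < N.
             (let q = entry_query s entry d L n (k, m)
                        (after_queries s entry d L n kms (mem st2))
              in mem q (''H'', 0) = gauss_newton_hessian s d L n W x f y $$ (k, m) \<and>
                 work q \<le> C * (d * n)))))"
proof (rule exI[of _ 13], rule exI[of _ forward_prog], rule exI[of _ "Seq backward_prog loss_prog"],
    rule exI[of _ entry_prog], intro allI impI)
  fix d L n :: nat and s :: "real \<Rightarrow> real" and W :: "nat \<Rightarrow> real mat" and x :: "nat \<Rightarrow> real vec"
    and y :: "nat \<Rightarrow> 'y" and f :: "real vec \<Rightarrow> 'y \<Rightarrow> real"
  assume pos: "d \<ge> 1" "L \<ge> 1" "n \<ge> 1" and diff: "\<forall>u. s differentiable (at u)"
    and W: "\<forall>l\<in>{1..L}. W l \<in> carrier_mat d d" and x: "\<forall>i<n. x i \<in> carrier_vec d"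
    and psd: "\<forall>i<n. sym_pos_semidef d (loss_hessian s L n W x f y i)"
  interpret dataset s d L W n x
    using pos diff W x by unfold_locales auto
  let ?Q = "loss_hessian s L n W x f y"
  have Q: "?Q i \<in> carrier_mat d d" if "i < n" for i
    using psd that by (simp add: sym_pos_semidef_def)
  have query: "n * (2 * d + 3) \<le> 13 * (d * n)"
    using mult_le_mono2[of "2 * d + 3" "13 * d" n] pos by (simp add: mult_ac)
  define st1 where "st1 = stage1 s forward_prog d L n W x"
  define st2 where "st2 = stage2 s (Seq backward_prog loss_prog) d L n ?Q st1"
  note stage2 = stage2_correct(3-5)[where Q = ?Q, OF Q, folded st1_def, folded st2_def]
  \<comment> \<open>The memory after \<open>kms\<close> agrees with \<open>st2\<close> on the three
    tables that a query reads.\<close>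
  have entries: "mem (entry_query s entry_prog d L n (k, m)
      (after_queries s entry_prog d L n kms (mem st2))) (''H'', 0) =
      gauss_newton_hessian s d L n W x f y $$ (k, m)"
    if "k < d\<^sup>2 * L" "m < d\<^sup>2 * L" for kms k m
    by (rule entry_query_correct[OF Q that])
      (simp_all add: mem_after_queries[OF _ refl] stage2)
  show "let N = d^2 * L;
           st1 = stage1 s forward_prog d L n W x;
           st2 = stage2 s (Seq backward_prog loss_prog) d L n (loss_hessian s L n W x f y) st1
       in
         (\<forall>i < n. \<forall>r < d. mem st1 (''out'', i * d + r) = forward s W (x i) L $ r) \<and>
         finite (used st2) \<and> card (used st2) \<le> 13 * (n * N) \<and>
         work st1 + work st2 \<le> 13 * (d * n * N) \<and>
         (\<forall>kms. set kms \<subseteq> {..<N} \<times> {..<N} \<longrightarrow>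
           (\<forall>k < N. \<forall>m < N.
             (let q = entry_query s entry_prog d L n (k, m)
                        (after_queries s entry_prog d L n kms (mem st2))
              in mem q (''H'', 0) = gauss_newton_hessian s d L n W x f y $$ (k, m) \<and>
                 work q \<le> 13 * (d * n))))"
    unfolding Let_def
    using stage1_correct(6) stored_cells[where Q = ?Q, OF Q] precomputation_work[where Q = ?Q, OF Q] entries
      order_trans[OF entry_query_exec(1) query]
    unfolding st1_def st2_def by blast
qed

end
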